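(* In the four-qubit symplectic polar space $W_4$, the following bounds on contextuality degrees of quadrics (with lines as contexts) hold: (1) there is an elliptic quadric with exactly $360$ negative lines whose contextuality degree is at most $351$; (2) there is an elliptic quadric with exactly $384$ negative lines whose contextuality degree is at most $363$; (3) there is a hyperbolic quadric with exactly $532$ negative lines whose contextuality degree is at most $500$; (4) there is a hyperbolic quadric with exactly $604$ negative lines whose contextuality degree is at most $500$; (5) the unique hyperbolic quadric with exactly $612$ negative lines has contextuality degree at most $517$.
   Context: $W_N=\mathcal{W}(2N-1,2)$ is the symplectic polar space on $\mathbb{F}_2^{2N}$ with symplectic form $\langle x|y\rangle=\sum_{i=1}^N (x_iy_{N+i}+x_{N+i}y_i)$; here $N=4$. Its points are the nonzero vectors of $\mathbb{F}_2^{2N}$; its lines are the sets $\{a,b,a+b\}$ with $a\neq b$ nonzero and $\langle a|b\rangle=0$. Let $I$ be the $2\times2$ identity matrix and $X=\begin{pmatrix}0&1\\1&0\end{pmatrix}$, $Y=\begin{pmatrix}0&-\mathrm{i}\\ \mathrm{i}&0\end{pmatrix}$, $Z=\begin{pmatrix}1&0\\0&-1\end{pmatrix}$. A point $(g_1,\dots,g_{2N})$ is identified with the (phase-free) $N$-qubit observable $G_1\otimes\cdots\otimes G_N$, $G_j\in\{I,X,Y,Z\}$, where $(g_j,g_{j+N})=(0,0),(0,1),(1,1),(1,0)$ corresponds to $G_j=I,X,Y,Z$ respectively. Two observables commute iff their vectors are orthogonal for the symplectic form. A line is positive (resp. negative) if the matrix product of its three observables is $I^{\otimes N}$ (resp.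 $-I^{\otimes N}$). A quadric of $W_N$ is the set of points $x$ with $Q(x)=0$, where $Q$ is a quadratic form on $\mathbb{F}_2^{2N}$ whose polar form $Q(x+y)+Q(x)+Q(y)$ is $\langle x|y\rangle$; equivalently $Q(x)=\sum_{i=1}^N x_ix_{N+i}+\langle p|x\rangle$ for some $p\in\mathbb{F}_2^{2N}$. It is hyperbolic (resp. elliptic) if $Q$ has Witt index $N$ (resp. $N-1$); for $N=4$ these have 135 (resp. 119) points. A quadric is regarded as a quantum configuration $(O,C)$ whose observables $O$ are its points and whose contexts $C$ are all the lines of $W_N$ contained in it (1575 for hyperbolic and 1071 for elliptic when $N=4$). For a configuration $(O,C)$, the incidence matrix $A\in\mathbb{F}_2^{|C|\times|O|}$ has $A_{i,j}=1$ iff the $i$-th context contains the $j$-th observable; the valuation vector $E\in\mathbb{F}_2^{|C|}$ has $E_i=0$ if the $i$-th context is positive and $E_i=1$ if it is negative. The contextuality degree is $d=d_H(E,\mathrm{Im}(A))$, the minimal Hamming distance from $E$ to a vector of the image of $A:\mathbb{F}_2^{|O|}\to\mathbb{F}_2^{|C|}$. *)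

theory Defs
  imports "HOL-Analysis.Analysis" "HOL-Library.Z2"
begin

(* The coordinates of F_2^(2N) are indexed by 'n + 'n with CARD('n) = N:
   Inl i is the coordinate number i and Inr i the coordinate number N + i. *)

type_synonym 'n symplectic_vec = "bit ^ ('n + 'n)"

definition symp :: "('n::finite) symplectic_vec \<Rightarrow> 'n symplectic_vec \<Rightarrow> bit" where
  "symp x y = (\<Sum>i\<in>UNIV. x $ Inl i * y $ Inr i + x $ Inr i * y $ Inl i)"

definition points :: "('n::finite) symplectic_vec set" where
  "points = {x. x \<noteq> 0}"

definition lines :: "('n::finite) symplectic_vec set set" where
  "lines = {{a, b, a + b} | a b. a \<in> points \<and> b \<in> points \<and> a \<noteq> b \<and> symp a b = 0}"


definition pauli_X :: "complex ^ 2 ^ 2" where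
  "pauli_X = vector [vector [0, 1], vector [1, 0]]"

definition pauli_Y :: "complex ^ 2 ^ 2" where
  "pauli_Y = vector [vector [0, - \<i>], vector [\<i>, 0]]"

definition pauli_Z :: "complex ^ 2 ^ 2" where
  "pauli_Z = vector [vector [1, 0], vector [0, - 1]]"

definition pauli :: "bit \<Rightarrow> bit \<Rightarrow> complex ^ 2 ^ 2" where
  "pauli a b =
     (if a = 0 then (if b = 0 then mat 1 else pauli_X)
      else (if b = 0 then pauli_Z else pauli_Y))"

(* Tensor product of a family of 2 x 2 matrices.  Rows and columns are indexed by the
   product basis of the N-fold tensor power of C^2, i.e. by families of indices 'n \<Rightarrow> 2. *)

definition tensor :: "('n::finite \<Rightarrow> complex ^ 2 ^ 2) \<Rightarrow> complex ^ (2 ^ 'n) ^ (2 ^ 'n)" where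
  "tensor G = (\<chi> r c. \<Prod>j\<in>UNIV. G j $ (r $ j) $ (c $ j))"

definition observable :: "('n::finite) symplectic_vec \<Rightarrow> complex ^ (2 ^ 'n) ^ (2 ^ 'n)" where
  "observable x = tensor (\<lambda>j. pauli (x $ Inl j) (x $ Inr j))"

(* The observables on a line commute pairwise, so their order in the product is immaterial. *)

definition positive_line :: "('n::finite) symplectic_vec set \<Rightarrow> bool" where
  "positive_line l \<longleftrightarrow>
     (\<exists>a b c. distinct [a, b, c] \<and> l = {a, b, c} \<and>
        observable a ** observable b ** observable c = mat 1)"

definition negative_line :: "('n::finite) symplectic_vec set \<Rightarrow> bool" where
  "negative_line l \<longleftrightarrow>
     (\<exists>a b c. distinct [a, b, c] \<and> l = {a, b, c} \<and>
        observable a ** observable b ** observable c = - mat 1)"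


(* Homogeneous polynomial functions of degree 2; over F_2 the diagonal terms matter, so a
   quadratic form is not determined by its polar form. *)

definition quadratic_form :: "(bit ^ 'm::finite \<Rightarrow> bit) \<Rightarrow> bool" where
  "quadratic_form Q \<longleftrightarrow>
     (\<exists>a :: 'm \<Rightarrow> 'm \<Rightarrow> bit. \<forall>x. Q x = (\<Sum>i\<in>UNIV. \<Sum>j\<in>UNIV. a i j * x $ i * x $ j))"

definition symp_quadratic_form :: "(('n::finite) symplectic_vec \<Rightarrow> bit) \<Rightarrow> bool" where
  "symp_quadratic_form Q \<longleftrightarrow>
     quadratic_form Q \<and> (\<forall>x y. Q (x + y) + Q x + Q y = symp x y)"

(* The maximal (vector space) dimension of a totally singular subspace. *)

definition witt_index :: "(bit ^ 'm::finite \<Rightarrow> bit) \<Rightarrow> nat" where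
  "witt_index Q = Max {vec.dim W | W. vec.subspace W \<and> (\<forall>x\<in>W. Q x = 0)}"

definition quadric_of :: "(('n::finite) symplectic_vec \<Rightarrow> bit) \<Rightarrow> 'n symplectic_vec set" where
  "quadric_of Q = {x \<in> points. Q x = 0}"

definition hyperbolic_quadric :: "('n::finite) symplectic_vec set \<Rightarrow> bool" where
  "hyperbolic_quadric S \<longleftrightarrow>
     (\<exists>Q. symp_quadratic_form Q \<and> S = quadric_of Q \<and> witt_index Q = CARD('n))"

definition elliptic_quadric :: "('n::finite) symplectic_vec set \<Rightarrow> bool" where
  "elliptic_quadric S \<longleftrightarrow>
     (\<exists>Q. symp_quadratic_form Q \<and> S = quadric_of Q \<and> witt_index Q = CARD('n) - 1)"


definition lines_in :: "('n::finite) symplectic_vec set \<Rightarrow> 'n symplectic_vec set set" where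
  "lines_in S = {l \<in> lines. l \<subseteq> S}"

definition negative_lines_in :: "('n::finite) symplectic_vec set \<Rightarrow> 'n symplectic_vec set set" where
  "negative_lines_in S = {l \<in> lines_in S. negative_line l}"


(* For a configuration (Obs, C), matrices over F_2 with rows indexed by C and columns by Obs
   are functions of a context and an observable, and vectors indexed by C are functions of a
   context; only their values on Obs and C are used. *)

definition incidence :: "'a set \<Rightarrow> 'a \<Rightarrow> bit" where
  "incidence c p = (if p \<in> c then 1 else 0)"

definition incidence_image :: "'a set \<Rightarrow> ('a set \<Rightarrow> bit) set" where
  "incidence_image Obs = range (\<lambda>(v :: 'a \<Rightarrow> bit) c. \<Sum>p\<in>Obs. incidence c p * v p)"

definition valuation :: "('n::finite) symplectic_vec set \<Rightarrow> bit" where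
  "valuation c = (if negative_line c then 1 else 0)"

definition hamming_dist :: "'c set \<Rightarrow> ('c \<Rightarrow> bit) \<Rightarrow> ('c \<Rightarrow> bit) \<Rightarrow> nat" where
  "hamming_dist C u w = card {c \<in> C. u c \<noteq> w c}"

definition contextuality_degree ::
  "('n::finite) symplectic_vec set \<Rightarrow> 'n symplectic_vec set set \<Rightarrow> nat" where
  "contextuality_degree Obs C = (INF w \<in> incidence_image Obs. hamming_dist C valuation w)"

definition quadric_degree :: "('n::finite) symplectic_vec set \<Rightarrow> nat" where
  "quadric_degree S = contextuality_degree S (lines_in S)"

end

theory Submission
  imports Defs
begin

text \<open>
  The quadratic forms polarising to the symplectic form are
  $Q_p(x) = \sum_i x_i x_{N+i} + \langle p|x\rangle$. Let $k$ be the number of qubits at which $p$ has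
  the letter $Y$. Everything that has to be counted is a sum of products over the qubits once
  the conditions $Q_p(a) = 0$, $Q_p(b) = 0$, $\langle a|b\rangle = 0$ are expanded into
  characters, so it factors into local sums that depend only on whether the letter of $p$ is $Y$.
  For $N = 4$ the number of negative lines is thereby 532, 384, 604, 360, 612 for $k = 0, \dots, 4$.

  Likewise $\sum_x (-1)^{Q_p(x)} = (-1)^k 2^N$. For a totally singular subspace $W$ of maximal
  size this sum equals $2|W| - |W^\perp|$, and $|W| |W^\perp| = 4^N$, which forces
  $|W| = 2^N$ or $|W| = 2^{N-1}$ according to the parity of $k$.

  For the degrees it suffices to flip the value of the observables in a small set $T$; the effect on
  the number of violated lines is a signed count of the pairs of points that meet $T$. The sets $T$ were
  found by simulated annealing.
\<close>

section \<open>Arithmetic of vectors over F_2\<close>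

instance bit :: finite
proof
  have "(UNIV :: bit set) \<subseteq> {0, 1}" by (auto intro: bit.exhaust)
  then show "finite (UNIV :: bit set)" by (rule finite_subset) simp
qed

lemma UNIV_bit: "(UNIV :: bit set) = {0, 1}"
  by (auto intro: bit.exhaust)

lemma CARD_bit [simp]: "CARD(bit) = 2"
  by (simp add: UNIV_bit)

(* These default rules would rewrite addition in the field to exclusive-or and then to parities. *)
declare add_bit_eq_xor [simp del] mult_bit_eq_and [simp del]

lemma bit_add_self [simp]: "x + x = (0 :: bit)"
  by (cases x) simp_all

lemma bit_vec_add_self [simp]: "x + x = (0 :: bit ^ 'm)"
  by (simp add: vec_eq_iff)

lemma bit_vec_add_self_left [simp]: "x + (x + y) = (y :: bit ^ 'm)"
  by (simp flip: add.assoc)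

lemma bit_vec_add_self_right [simp]: "(y + x) + x = (y :: bit ^ 'm)"
  by (simp add: add.assoc)

subsection \<open>Letters\<close>

definition letter :: "'n::finite symplectic_vec \<Rightarrow> 'n \<Rightarrow> bit \<times> bit" where
  "letter x j = (x $ Inl j, x $ Inr j)"

definition word :: "('n::finite \<Rightarrow> bit \<times> bit) \<Rightarrow> 'n symplectic_vec" where
  "word f = (\<chi> i. case i of Inl j \<Rightarrow> fst (f j) | Inr j \<Rightarrow> snd (f j))"

lemma letter_word [simp]: "letter (word f) = f"
  by (rule ext) (simp add: letter_def word_def)

lemma word_letter [simp]: "word (letter x) = x"
  by (simp add: letter_def word_def vec_eq_iff split: sum.split)

lemma letter_add: "letter (x + y) j = letter x j + letter y j"
  by (simp add: letter_def)

lemma letter_zero [simp]: "letter 0 j = 0"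
  by (simp add: letter_def zero_prod_def)

text \<open>Distributivity: expanding the product picks one letter per qubit, and these choices are
  exactly the words of points. It reduces every later sum over points to one-qubit sums.\<close>

lemma sum_prod_letter:
  fixes f :: "'n::finite \<Rightarrow> bit \<times> bit \<Rightarrow> 'a::comm_semiring_1"
  shows "(\<Sum>x\<in>UNIV. \<Prod>j\<in>UNIV. f j (letter x j)) = (\<Prod>j\<in>UNIV. \<Sum>l\<in>UNIV. f j l)"
proof -
  have "(\<Prod>j\<in>UNIV. \<Sum>l\<in>UNIV. f j l) = (\<Sum>g\<in>UNIV. \<Prod>j\<in>UNIV. f j (g j))"
    by (subst prod_sum_PiE) (auto simp: PiE_UNIV_domain)
  also have "\<dots> = (\<Sum>x\<in>UNIV. \<Prod>j\<in>UNIV. f j (letter x j))"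
    by (rule sum.reindex_bij_witness[of _ letter word]) auto
  finally show ?thesis ..
qed

lemma sum_sum_prod_letter:
  fixes f :: "'n::finite \<Rightarrow> bit \<times> bit \<Rightarrow> bit \<times> bit \<Rightarrow> 'a::comm_semiring_1"
  shows "(\<Sum>x\<in>UNIV. \<Sum>y\<in>UNIV. \<Prod>j\<in>UNIV. f j (letter x j) (letter y j))
       = (\<Prod>j\<in>UNIV. \<Sum>l\<in>UNIV. \<Sum>m\<in>UNIV. f j l m)"
proof -
  have "(\<Sum>y\<in>UNIV. \<Prod>j\<in>UNIV. f j (letter x j) (letter y j)) = (\<Prod>j\<in>UNIV. \<Sum>m\<in>UNIV. f j (letter x j) m)"
    for x by (rule sum_prod_letter)
  then show ?thesis
    using sum_prod_letter[of "\<lambda>j l. \<Sum>m\<in>UNIV. f j l m"] by simp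
qed

section \<open>The additive character of F_2 and the symplectic form\<close>

definition sgn_bit :: "bit \<Rightarrow> complex" where
  "sgn_bit b = (if b = 0 then 1 else - 1)"

lemma sgn_bit_simps [simp]: "sgn_bit 0 = 1" "sgn_bit 1 = - 1"
  by (simp_all add: sgn_bit_def)

lemma sgn_bit_add: "sgn_bit (a + b) = sgn_bit a * sgn_bit b"
  by (cases a; cases b) simp_all

lemma sgn_bit_sum: "finite A \<Longrightarrow> sgn_bit (\<Sum>i\<in>A. f i) = (\<Prod>i\<in>A. sgn_bit (f i))"
  by (induction A rule: finite_induct) (simp_all add: sgn_bit_add)

definition symp_letter :: "bit \<times> bit \<Rightarrow> bit \<times> bit \<Rightarrow> bit" where
  "symp_letter l m = fst l * snd m + snd l * fst m"

lemma symp_letters: "symp x y = (\<Sum>j\<in>UNIV. symp_letter (letter x j) (letter y j))"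
  by (simp add: symp_def symp_letter_def letter_def)

lemma symp_add_left: "symp (x + y) z = symp x z + symp y z"
  by (simp add: symp_def algebra_simps sum.distrib)

lemma symp_commute: "symp x y = symp y x"
  by (simp add: symp_def mult.commute add.commute)

lemma symp_add_right: "symp x (y + z) = symp x y + symp x z"
  by (metis symp_add_left symp_commute)

lemma symp_self [simp]: "symp x x = 0"
  by (simp add: symp_def mult.commute)

lemma symp_zero [simp]: "symp 0 x = 0" "symp x 0 = 0"
  by (simp_all add: symp_def)

lemma symp_nondegenerate:
  fixes x :: "'n::finite symplectic_vec"
  assumes "\<And>y. symp x y = 0"
  shows "x = 0"
proof -
  have "x $ i = 0" for i
  proof (cases i)
    case (Inl j)
    have "symp x (axis (Inr j) 1) = x $ Inl j"
      by (simp add: symp_def axis_def if_distrib[of "(*) _"] cong: if_cong)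
    with assms Inl show ?thesis by simp
  next
    case (Inr j)
    have "symp x (axis (Inl j) 1) = x $ Inr j"
      by (simp add: symp_def axis_def if_distrib[of "(*) _"] cong: if_cong)
    with assms Inr show ?thesis by simp
  qed
  then show ?thesis by (simp add: vec_eq_iff)
qed

subsection \<open>Quadratic forms\<close>

definition qform_letter :: "bit \<times> bit \<Rightarrow> bit \<times> bit \<Rightarrow> bit" where
  "qform_letter p l = fst l * snd l + symp_letter p l"

definition qform :: "'n::finite symplectic_vec \<Rightarrow> 'n symplectic_vec \<Rightarrow> bit" where
  "qform p x = (\<Sum>j\<in>UNIV. qform_letter (letter p j) (letter x j))"

lemma qform_eq: "qform p x = (\<Sum>j\<in>UNIV. x $ Inl j * x $ Inr j) + symp p x"
  by (simp add: qform_def qform_letter_def symp_letters sum.distrib) (simp add: letter_def)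

lemma qform_zero [simp]: "qform p 0 = 0"
  by (simp add: qform_eq)

lemma qform_add: "qform p (x + y) = qform p x + qform p y + symp x y"
  by (simp add: qform_eq symp_add_right) (simp add: symp_def algebra_simps sum.distrib)

lemma symp_quadratic_form_qform: "symp_quadratic_form (qform p)"
  for p :: "'n::finite symplectic_vec"
proof -
  \<comment> \<open>Since b * b = b in F_2, the linear form <p|x> can sit on the diagonal; the
    entries at (\<open>Inl i\<close>, \<open>Inr i\<close>) carry the hyperbolic part.\<close>
  define a :: "'n + 'n \<Rightarrow> 'n + 'n \<Rightarrow> bit" where
    "a = (\<lambda>s t. case s of
        Inl i \<Rightarrow> (case t of Inl j \<Rightarrow> of_bool (i = j) * p $ Inr i | Inr j \<Rightarrow> of_bool (i = j))
      | Inr i \<Rightarrow> (case t of Inl j \<Rightarrow> 0 | Inr j \<Rightarrow> of_bool (i = j) * p $ Inl i))"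
  have sq: "b * b = b" "b * (b * c) = b * c" for b c :: bit by (cases b; simp)+
  have "qform p x = (\<Sum>s\<in>UNIV. \<Sum>t\<in>UNIV. a s t * x $ s * x $ t)" for x
    by (simp add: qform_eq symp_def a_def sum.Plus sum.distrib of_bool_def if_distrib if_distribR
        mult.assoc sq add_ac mult_ac flip: UNIV_Plus_UNIV cong: if_cong)
  then have "quadratic_form (qform p)" by (auto simp: quadratic_form_def)
  moreover have "qform p (x + y) + qform p x + qform p y = symp x y" for x y
    by (simp add: qform_add add_ac)
  ultimately show ?thesis by (simp add: symp_quadratic_form_def)
qed

lemma additive_eq_symp:
  fixes L :: "'n::finite symplectic_vec \<Rightarrow> bit"
  assumes add: "\<And>x y. L (x + y) = L x + L y"
  obtains p where "L = symp p"
proof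
  \<comment> \<open>The form pairs \<open>Inl j\<close> with \<open>Inr j\<close>, so the
    coordinates of \<open>p\<close> are the values of \<open>L\<close> on the unit vectors with the
    two halves exchanged.\<close>
  define p where "p = word (\<lambda>j. (L (axis (Inr j) 1), L (axis (Inl j) 1)))"
  have L0: "L 0 = 0" using add[of 0 0] by simp
  have Lsum: "L (sum f A) = (\<Sum>i\<in>A. L (f i))" if "finite A" for f and A :: "('n + 'n) set"
    using that by (induction A rule: finite_induct) (simp_all add: L0 add)
  have Ls: "L (b *s v) = b * L v" for b v
    by (cases b) (simp_all add: L0)
  show "L = symp p"
  proof
    fix x
    have "L x = L (\<Sum>i\<in>UNIV. x $ i *s axis i 1)" by (simp add: basis_expansion)
    also have "\<dots> = (\<Sum>i\<in>UNIV. x $ i * L (axis i 1))" by (simp add: Lsum Ls)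
    also have "\<dots> = symp p x"
      by (simp add: symp_def p_def word_def sum.Plus sum.distrib mult.commute add.commute flip: UNIV_Plus_UNIV)
    finally show "L x = symp p x" .
  qed
qed

text \<open>Two forms with the same polar form differ by an additive function, and every additive
  function is <p|.> for some p.\<close>

lemma symp_quadratic_form_iff: "symp_quadratic_form Q \<longleftrightarrow> (\<exists>p. Q = qform p)"
proof
  assume Q: "symp_quadratic_form Q"
  define L where "L x = Q x + qform 0 x" for x
  have polar: "Q (x + y) = Q x + Q y + symp x y" for x y
  proof -
    have "Q (x + y) + Q x + Q y = symp x y" using Q by (simp add: symp_quadratic_form_def)
    then show ?thesis by (cases "Q (x + y)"; cases "Q x"; cases "Q y"; cases "symp x y") simp_all
  qed
  have "L (x + y) = L x + L y" for x y
    unfolding L_def polar qform_add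
    by (cases "symp x y") (simp_all add: ac_simps)
  then obtain p where p: "L = symp p" by (rule additive_eq_symp) blast
  have "Q x = qform p x" for x
  proof -
    have "qform 0 x + symp p x = qform p x" by (simp add: qform_eq)
    moreover have "Q x = qform 0 x + L x" by (simp add: L_def add.left_commute)
    ultimately show ?thesis using p by simp
  qed
  then show "\<exists>p. Q = qform p" by blast
qed (use symp_quadratic_form_qform in blast)

subsection \<open>Products of observables\<close>

text \<open>The scalar equal to the product of the Pauli matrices of \<open>l\<close>,
  \<open>m\<close> and \<open>l + m\<close>; it is i when \<open>l\<close>, \<open>m\<close> are
  consecutive in the cycle X, Y, Z.\<close>

definition phase_letter :: "bit \<times> bit \<Rightarrow> bit \<times> bit \<Rightarrow> complex" where
  "phase_letter l m =
     (if l = 0 \<or> m = 0 \<or> l = m then 1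
      else if (l, m) \<in> {((0, 1), (1, 1)), ((1, 1), (1, 0)), ((1, 0), (0, 1))} then \<i> else - \<i>)"

definition phase :: "'n::finite symplectic_vec \<Rightarrow> 'n symplectic_vec \<Rightarrow> complex" where
  "phase x y = (\<Prod>j\<in>UNIV. phase_letter (letter x j) (letter y j))"

lemma letter_cases:
  fixes l :: "bit \<times> bit"
  obtains "l = (0, 0)" | "l = (0, 1)" | "l = (1, 0)" | "l = (1, 1)"
  by (cases l) (metis bit.exhaust)

lemma pauli_mult:
  "pauli (fst l) (snd l) ** pauli (fst m) (snd m) ** pauli (fst (l + m)) (snd (l + m))
     = mat (phase_letter l m)"
  by (cases l rule: letter_cases; cases m rule: letter_cases)
     (simp_all add: pauli_def pauli_X_def pauli_Y_def pauli_Z_def phase_letter_def zero_prod_def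
        vec_eq_iff forall_2 matrix_matrix_mult_def sum_2 mat_def)

text \<open>The intermediate index of the matrix product consists of one index per qubit, so the sum
  factors by distributivity.\<close>

lemma tensor_mult: "tensor G ** tensor H = tensor (\<lambda>j. G j ** H j)"
proof -
  have "(\<Sum>k\<in>UNIV. (\<Prod>j\<in>UNIV. G j $ (r $ j) $ (k $ j)) * (\<Prod>j\<in>UNIV. H j $ (k $ j) $ (c $ j)))
      = (\<Prod>j\<in>UNIV. \<Sum>k\<in>UNIV. G j $ (r $ j) $ k * H j $ k $ (c $ j))" for r c :: "2 ^ 'a"
  proof -
    have "(\<Prod>j\<in>UNIV. \<Sum>k\<in>UNIV. G j $ (r $ j) $ k * H j $ k $ (c $ j))
        = (\<Sum>g\<in>UNIV. \<Prod>j\<in>UNIV. G j $ (r $ j) $ g j * H j $ g j $ (c $ j))"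
      by (subst prod_sum_PiE) (auto simp: PiE_UNIV_domain)
    also have "\<dots> = (\<Sum>k\<in>UNIV. \<Prod>j\<in>UNIV. G j $ (r $ j) $ (k $ j) * H j $ (k $ j) $ (c $ j))"
      by (rule sum.reindex_bij_witness[of _ vec_nth vec_lambda]) auto
    finally show ?thesis by (simp add: prod.distrib)
  qed
  then show ?thesis
    by (simp add: tensor_def matrix_matrix_mult_def vec_eq_iff)
qed

lemma tensor_mat: "tensor (\<lambda>j. mat (c j)) = mat (\<Prod>j\<in>UNIV. c j)"
proof -
  have "(\<Prod>j\<in>UNIV. if r $ j = k $ j then c j else 0) = (if r = k then (\<Prod>j\<in>UNIV. c j) else 0)"
    for r k :: "2 ^ 'a"
    by (auto simp: vec_eq_iff)
  then show ?thesis by (simp add: tensor_def mat_def vec_eq_iff)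
qed

lemma observable_mult: "observable x ** observable y ** observable (x + y) = mat (phase x y)"
proof -
  have "observable z = tensor (\<lambda>j. pauli (fst (letter z j)) (snd (letter z j)))" for z :: "'a symplectic_vec"
    by (simp add: observable_def letter_def)
  then show ?thesis
    by (simp add: tensor_mult letter_add pauli_mult tensor_mat phase_def del: fst_add snd_add)
qed

text \<open>Exchanging the letters, or replacing \<open>m\<close> by \<open>l + m\<close> as in the
  next lemma, changes the local phase by the commutation sign. For orthogonal points these signs
  multiply to 1, so the global phase depends only on the line.\<close>

lemma phase_letter_swap: "phase_letter m l = sgn_bit (symp_letter l m) * phase_letter l m"
  by (cases l rule: letter_cases; cases m rule: letter_cases)
     (simp_all add: phase_letter_def symp_letter_def zero_prod_def)

lemma phase_letter_add: "phase_letter l (l + m) = sgn_bit (symp_letter l m) * phase_letter l m"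
  by (cases l rule: letter_cases; cases m rule: letter_cases)
     (simp_all add: phase_letter_def symp_letter_def zero_prod_def)

lemma phase_letter_sq: "phase_letter l m * phase_letter l m = sgn_bit (symp_letter l m)"
  by (cases l rule: letter_cases; cases m rule: letter_cases)
     (simp_all add: phase_letter_def symp_letter_def zero_prod_def)

lemma sgn_symp: "sgn_bit (symp x y) = (\<Prod>j\<in>UNIV. sgn_bit (symp_letter (letter x j) (letter y j)))"
  by (simp add: symp_letters sgn_bit_sum)

lemma phase_swap: "symp x y = 0 \<Longrightarrow> phase y x = phase x y"
  using sgn_symp[of x y] by (simp add: phase_def phase_letter_swap[of "letter y _"] prod.distrib)

lemma phase_add: "symp x y = 0 \<Longrightarrow> phase x (x + y) = phase x y"
  using sgn_symp[of x y] by (simp add: phase_def letter_add phase_letter_add prod.distrib)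

lemma phase_sq: "phase x y * phase x y = sgn_bit (symp x y)"
  by (simp add: phase_def sgn_symp phase_letter_sq flip: prod.distrib)

lemma phase_cases: "symp x y = 0 \<Longrightarrow> phase x y = 1 \<or> phase x y = - 1"
  using phase_sq[of x y] by (simp add: square_eq_1_iff)

lemma phase_degenerate [simp]: "phase 0 x = 1" "phase x 0 = 1" "phase x x = 1"
  by (simp_all add: phase_def phase_letter_def)

lemma mat_eq_iff: "(mat a :: complex ^ 'm ^ 'm) = mat b \<longleftrightarrow> a = b"
  by (auto simp: mat_def vec_eq_iff)

lemma uminus_mat: "- mat a = (mat (- a) :: complex ^ 'm ^ 'm)"
  by (auto simp: mat_def vec_eq_iff)

lemma negative_line_iff:
  fixes a b :: "'n::finite symplectic_vec"
  assumes ab: "a \<noteq> 0" "b \<noteq> 0" "a \<noteq> b" and orth: "symp a b = 0"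
  shows "negative_line {a, b, a + b} \<longleftrightarrow> phase a b = - 1"
proof -
  have sum_eq: "x + y = 0 \<longleftrightarrow> x = y" "x + y = x \<longleftrightarrow> y = 0" "x + y = y \<longleftrightarrow> x = 0" for x y :: "'n symplectic_vec"
    by (metis add.right_neutral bit_vec_add_self bit_vec_add_self_left add.commute)+
  have dist: "distinct [a, b, a + b]" using ab by (auto simp: sum_eq)
  have obs: "observable x ** observable y ** observable (x + y) = - mat 1 \<longleftrightarrow> phase x y = - 1"
    for x y :: "'n symplectic_vec"
    by (simp add: observable_mult uminus_mat mat_eq_iff)
  \<comment> \<open>A negative line may be witnessed by any ordering of its points. In all six
    orderings the third point is the sum of the other two and the phase is the same.\<close>
  have key: "z = x + y \<and> phase x y = phase a b"
    if "distinct [x, y, z]" "{a, b, a + b} = {x, y, z}" for x y z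
  proof -
    have o2: "symp b a = 0" "symp a (a + b) = 0" "symp b (a + b) = 0"
      using orth by (simp_all add: symp_add_right symp_commute)
    have ph: "phase b a = phase a b" "phase a (a + b) = phase a b" "phase (a + b) a = phase a b"
        "phase b (a + b) = phase a b" "phase (a + b) b = phase a b"
      using phase_swap[OF orth] phase_add[OF orth] phase_swap[OF o2(2)] phase_swap[OF o2(3)]
        phase_add[OF o2(1)] by (simp_all add: add.commute)
    have "(x, y, z) \<in> {(a, b, a + b), (b, a, a + b), (a, a + b, b), (b, a + b, a), (a + b, a, b), (a + b, b, a)}"
      using that dist by (simp add: set_eq_iff) metis
    then show ?thesis
      using ph by (auto simp: add_ac)
  qed
  show ?thesis
    unfolding negative_line_def using key dist obs by metis
qed

subsection \<open>The Witt index\<close>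

lemma subspace_bit_iff:
  fixes W :: "(bit ^ 'm::finite) set"
  shows "vec.subspace W \<longleftrightarrow> 0 \<in> W \<and> (\<forall>x\<in>W. \<forall>y\<in>W. x + y \<in> W)"
proof -
  have "c *s x = 0 \<or> c *s x = x" for c and x :: "bit ^ 'm"
    by (cases c) auto
  then show ?thesis unfolding vec.subspace_def by metis
qed

text \<open>A new basis vector outside the span adjoins a disjoint coset of it, which doubles the
  cardinality.\<close>

lemma card_subspace:
  fixes W :: "(bit ^ 'm::finite) set"
  assumes "vec.subspace W"
  shows "card W = 2 ^ vec.dim W"
proof -
  have span: "card (vec.span B) = 2 ^ card B" if "vec.independent B" for B :: "(bit ^ 'm) set"
  proof -
    have "finite B" by simp
    then show ?thesis using that
    proof (induction B rule: finite_induct)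
      case (insert a B)
      then have a: "a \<notin> vec.span B" and B: "vec.independent B"
        by (auto simp: vec.independent_insert)
      have "(\<exists>k. x - k *s a \<in> V) \<longleftrightarrow> x \<in> V \<or> x + a \<in> V" for x and V :: "(bit ^ 'm) set"
      proof -
        have "x - 0 *s a = x" by simp
        moreover have "x - 1 *s a = x + a" by (simp add: vec_eq_iff)
        moreover have "k = 0 \<or> k = 1" for k :: bit by (cases k) simp_all
        ultimately show ?thesis by metis
      qed
      then have "vec.span (insert a B) = {x. x \<in> vec.span B \<or> x + a \<in> vec.span B}"
        unfolding vec.span_insert by blast
      also have "\<dots> = vec.span B \<union> (\<lambda>x. x + a) ` vec.span B"
      proof -
        have "x + a \<in> vec.span B \<longleftrightarrow> x \<in> (\<lambda>x. x + a) ` vec.span B" for x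
        proof
          assume "x + a \<in> vec.span B"
          then have "(x + a) + a \<in> (\<lambda>x. x + a) ` vec.span B" by (rule imageI)
          then show "x \<in> (\<lambda>x. x + a) ` vec.span B" by simp
        qed auto
        then show ?thesis by blast
      qed
      finally have eq: "vec.span (insert a B) = vec.span B \<union> (\<lambda>x. x + a) ` vec.span B" .
      have "vec.span B \<inter> (\<lambda>x. x + a) ` vec.span B = {}"
        using a vec.span_add_eq by blast
      then have "card (vec.span (insert a B)) = card (vec.span B) + card ((\<lambda>x. x + a) ` vec.span B)"
        unfolding eq by (intro card_Un_disjoint) auto
      also have "card ((\<lambda>x. x + a) ` vec.span B) = card (vec.span B)"
        by (intro card_image) (auto simp: inj_on_def)
      finally show ?case using insert B by simp
    qed simp
  qed
  obtain B where B: "B \<subseteq> W" "vec.independent B" "W \<subseteq> vec.span B" "card B = vec.dim W"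
    by (rule vec.basis_exists)
  then have "vec.span B = W"
    using assms vec.span_minimal by blast
  with span[OF B(2)] B(4) show ?thesis by simp
qed

definition perp :: "'n::finite symplectic_vec set \<Rightarrow> 'n symplectic_vec set" where
  "perp W = {x. \<forall>w\<in>W. symp x w = 0}"

lemma perp_UNIV: "perp UNIV = {0}"
  using symp_nondegenerate by (auto simp: perp_def)

text \<open>Orthogonality of characters: outside \<open>perp W\<close> some v in \<open>W\<close>
  has symplectic product 1 with \<open>x\<close>, and translating the sum by v negates it.\<close>

lemma sum_sgn_symp:
  assumes "vec.subspace W"
  shows "(\<Sum>w\<in>W. sgn_bit (symp x w)) = (if x \<in> perp W then of_nat (card W) else 0)"
proof (cases "x \<in> perp W")
  case True
  then show ?thesis by (simp add: perp_def)
next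
  case False
  then obtain v where v: "v \<in> W" "symp x v = 1" by (auto simp: perp_def)
  have "(\<Sum>w\<in>W. sgn_bit (symp x w)) = (\<Sum>w\<in>W. sgn_bit (symp x (v + w)))"
    by (rule sum.reindex_bij_witness[of _ "(+) v" "(+) v"]) (use assms v in \<open>auto simp: subspace_bit_iff\<close>)
  also have "\<dots> = - (\<Sum>w\<in>W. sgn_bit (symp x w))"
    using v by (simp add: symp_add_right sgn_bit_add sum_negf)
  finally show ?thesis using False by simp
qed

text \<open>The double sum of signs over all x and all w in \<open>W\<close> is evaluated in both
  orders: summing over w first leaves \<open>perp W\<close>, summing over x first leaves w = 0 by
  nondegeneracy.\<close>

lemma card_perp:
  fixes W :: "'n::finite symplectic_vec set"
  assumes "vec.subspace W"
  shows "card W * card (perp W) = 2 ^ CARD('n) * 2 ^ CARD('n)"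
proof -
  have "(\<Sum>x\<in>UNIV. \<Sum>w\<in>W. sgn_bit (symp x w)) = of_nat (card W * card (perp W))"
    using assms by (simp add: sum_sgn_symp sum.If_cases mult.commute)
  moreover have "(\<Sum>x\<in>UNIV. \<Sum>w\<in>W. sgn_bit (symp x w)) = of_nat (2 ^ CARD('n) * 2 ^ CARD('n))"
  proof -
    have "(\<Sum>x\<in>UNIV. \<Sum>w\<in>W. sgn_bit (symp x w)) = (\<Sum>w\<in>W. \<Sum>x\<in>UNIV. sgn_bit (symp w x))"
      by (subst sum.swap) (simp add: symp_commute)
    also have "\<dots> = (\<Sum>w\<in>W. if w = 0 then of_nat (CARD('n symplectic_vec)) else 0)"
      by (subst sum_sgn_symp) (auto simp: subspace_bit_iff perp_UNIV)
    also have "\<dots> = of_nat (2 ^ CARD('n) * 2 ^ CARD('n))"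
      using assms by (simp add: subspace_bit_iff UNIV_bit power_add)
    finally show ?thesis .
  qed
  ultimately show ?thesis by (metis of_nat_eq_iff)
qed

text \<open>Average over translations by \<open>W\<close>: as Q(x + w) = Q(x) + <x|w> for w in
  \<open>W\<close>, the sum over w removes every x outside \<open>perp W\<close>.\<close>

lemma sum_sgn_qform_perp:
  assumes W: "vec.subspace W" and sing: "\<And>x. x \<in> W \<Longrightarrow> qform p x = 0"
  shows "(\<Sum>x\<in>UNIV. sgn_bit (qform p x)) = (\<Sum>x\<in>perp W. sgn_bit (qform p x))"
proof -
  have "of_nat (card W) * (\<Sum>x\<in>UNIV. sgn_bit (qform p x))
      = (\<Sum>w\<in>W. \<Sum>x\<in>UNIV. sgn_bit (qform p (x + w)))"
  proof -
    have "(\<Sum>x\<in>UNIV. sgn_bit (qform p (x + w))) = (\<Sum>x\<in>UNIV. sgn_bit (qform p x))" for w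
      by (rule sum.reindex_bij_witness[of _ "\<lambda>x. x + w" "\<lambda>x. x + w"]) auto
    then show ?thesis by simp
  qed
  also have "\<dots> = (\<Sum>x\<in>UNIV. sgn_bit (qform p x) * (\<Sum>w\<in>W. sgn_bit (symp x w)))"
    by (subst sum.swap) (simp add: qform_add sing sgn_bit_add sum_distrib_left)
  also have "\<dots> = of_nat (card W) * (\<Sum>x\<in>perp W. sgn_bit (qform p x))"
    using W by (simp add: sum_sgn_symp if_distrib sum.If_cases mult.commute flip: sum_distrib_left cong: if_cong)
  finally show ?thesis
    using W by (auto simp: subspace_bit_iff card_eq_0_iff)
qed

text \<open>At a letter Y the local form is the anisotropic plane, at any other letter a hyperbolic
  plane. The parity of this count is the Arf invariant of the form.\<close>

definition elliptic_letters :: "'n::finite symplectic_vec \<Rightarrow> nat" where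
  "elliptic_letters p = card {j. letter p j = (1, 1)}"

lemma prod_elliptic_letters:
  fixes p :: "'n::finite symplectic_vec" and u v :: complex
  shows "(\<Prod>j\<in>UNIV. if letter p j = (1, 1) then u else v)
       = u ^ elliptic_letters p * v ^ (CARD('n) - elliptic_letters p)"
  by (simp add: prod.If_cases elliptic_letters_def card_Diff_subset Compl_eq_Diff_UNIV)

lemma elliptic_letters_le: "elliptic_letters (p :: 'n::finite symplectic_vec) \<le> CARD('n)"
  by (simp add: elliptic_letters_def card_mono)

lemma UNIV_letter: "(UNIV :: (bit \<times> bit) set) = {(0, 0), (0, 1), (1, 0), (1, 1)}"
  by (auto simp flip: UNIV_Times_UNIV simp: UNIV_bit)

lemma sum_letter: "(\<Sum>l\<in>UNIV. f l) = f (0, 0) + f (0, 1) + f (1, 0) + f (1, 1)"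
  for f :: "bit \<times> bit \<Rightarrow> 'a::comm_monoid_add"
  by (simp add: UNIV_letter add.assoc)

lemma sum_sgn_qform:
  fixes p :: "'n::finite symplectic_vec"
  shows "(\<Sum>x\<in>UNIV. sgn_bit (qform p x)) = (- 1) ^ elliptic_letters p * 2 ^ CARD('n)"
proof -
  have local: "(\<Sum>l\<in>UNIV. sgn_bit (qform_letter m l)) = (if m = (1, 1) then - 2 else 2)" for m
    by (cases m rule: letter_cases) (simp_all add: sum_letter qform_letter_def symp_letter_def)
  have "(\<Sum>x\<in>UNIV. sgn_bit (qform p x)) = (\<Prod>j\<in>UNIV. if letter p j = (1, 1) then - 2 else 2)"
    using sum_prod_letter[of "\<lambda>j l. sgn_bit (qform_letter (letter p j) l)"]
    by (simp add: qform_def sgn_bit_sum local)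
  also have "\<dots> = (- 1) ^ elliptic_letters p * 2 ^ CARD('n)"
    using elliptic_letters_le[of p]
    by (simp add: prod_elliptic_letters power_minus[of 2] mult.assoc flip: power_add)
  finally show ?thesis .
qed

text \<open>With n = 2^N and w the size of a maximal totally singular subspace, these are the
  equations of the even and the odd case. They factor as (w - n)(2w + n) = 0 and (2w - n)(w + n) =
  0.\<close>

lemma quadratic_nat_roots:
  fixes w n :: nat
  assumes "n > 0"
  shows "w * n + n * n = 2 * (w * w) \<Longrightarrow> w = n" and "2 * (w * w) + w * n = n * n \<Longrightarrow> 2 * w = n"
proof -
  assume "w * n + n * n = 2 * (w * w)"
  then have "int w * int n + int n * int n = 2 * (int w * int w)"
    by (metis of_nat_add of_nat_mult of_nat_numeral)
  then have "(int w - int n) * (2 * int w + int n) = 0" by (simp add: algebra_simps)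
  with assms show "w = n" by auto
next
  assume "2 * (w * w) + w * n = n * n"
  then have "2 * (int w * int w) + int w * int n = int n * int n"
    by (metis of_nat_add of_nat_mult of_nat_numeral)
  then have "(2 * int w - int n) * (int w + int n) = 0" by (simp add: algebra_simps)
  with assms show "2 * w = n" by auto
qed

lemma witt_index_qform:
  fixes p :: "'n::finite symplectic_vec"
  shows "witt_index (qform p) = (if even (elliptic_letters p) then CARD('n) else CARD('n) - 1)"
proof -
  define D where "D = {vec.dim W | W. vec.subspace W \<and> (\<forall>x\<in>W. qform p x = 0)}"
  have "D = vec.dim ` {W. vec.subspace W \<and> (\<forall>x\<in>W. qform p x = 0)}" by (auto simp: D_def)
  then have fin: "finite D" by simp
  \<comment> \<open>The zero subspace makes \<open>D\<close> nonempty, so that \<open>Max D\<close>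
    is attained.\<close>
  have "{0 :: 'n symplectic_vec} \<in> {W. vec.subspace W \<and> (\<forall>x\<in>W. qform p x = 0)}" 
    by (simp add: subspace_bit_iff)
  then have "D \<noteq> {}" unfolding D_def by blast
  with fin have "Max D \<in> D" by (rule Max_in)
  then obtain W where W: "vec.subspace W" and sing: "\<And>x. x \<in> W \<Longrightarrow> qform p x = 0"
    and dimW: "vec.dim W = Max D"
    unfolding D_def by auto
  have orth: "symp x y = 0" if "x \<in> W" "y \<in> W" for x y
    using that W sing[of x] sing[of y] sing[of "x + y"] by (auto simp: subspace_bit_iff qform_add)
  then have sub: "W \<subseteq> perp W" by (auto simp: perp_def)
  \<comment> \<open>A singular \<open>x\<close> in \<open>perp W\<close> but outside
    \<open>W\<close> would extend \<open>W\<close> to a totally singular subspace of twice the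
    size.\<close>
  have maximal: "x \<in> W" if x: "x \<in> perp W" "qform p x = 0" for x
  proof (rule ccontr)
    assume "x \<notin> W"
    define V where "V = W \<union> (+) x ` W"
    have add_x: "x + (y + z) = y + (x + z)" for y z by (simp add: add.left_commute)
    have V: "vec.subspace V"
      using W unfolding V_def subspace_bit_iff
      by (auto simp: image_iff add.assoc add_x[of _ "x + _"] Bex_def)
    have "qform p y = 0" if "y \<in> V" for y
      using that sing x orth by (auto simp: V_def qform_add perp_def)
    with V have "vec.dim V \<in> D" unfolding D_def by blast
    then have "vec.dim V \<le> vec.dim W" unfolding dimW using fin by simp
    moreover have "card V = 2 * card W"
    proof -
      have "W \<inter> (+) x ` W = {}"
      proof (rule ccontr)
        assume "W \<inter> (+) x ` W \<noteq> {}"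
        then obtain w where "w \<in> W" "x + w \<in> W" by auto
        then have "(x + w) + w \<in> W" using W unfolding subspace_bit_iff by blast
        then show False using \<open>x \<notin> W\<close> by simp
      qed
      then show ?thesis unfolding V_def by (simp add: card_Un_disjoint card_image inj_on_def)
    qed
    ultimately have "vec.dim V \<le> vec.dim W" "(2::nat) ^ vec.dim V = 2 ^ Suc (vec.dim W)"
      using card_subspace[OF V] card_subspace[OF W] by simp_all
    then show False by (simp only: power_inject_exp)
  qed
  define w where "w = card W"
  define P where "P = card (perp W)"
  have w: "w = 2 ^ Max D" using card_subspace[OF W] dimW by (simp add: w_def)
  have wP: "w * P = 2 ^ CARD('n) * 2 ^ CARD('n)" unfolding w_def P_def by (rule card_perp[OF W])
  have "(\<Sum>x\<in>perp W. sgn_bit (qform p x))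
      = (\<Sum>x\<in>perp W - W. sgn_bit (qform p x)) + (\<Sum>x\<in>W. sgn_bit (qform p x))"
    using sub by (intro sum.subset_diff) auto
  also have "(\<Sum>x\<in>perp W - W. sgn_bit (qform p x)) = (\<Sum>x\<in>perp W - W. - 1)"
  proof (rule sum.cong)
    fix x assume "x \<in> perp W - W"
    then have "qform p x \<noteq> 0" using maximal by blast
    then show "sgn_bit (qform p x) = - 1" by simp
  qed simp
  also have "\<dots> = of_nat w - of_nat P"
  proof -
    have "card (perp W - W) = P - w" "w \<le> P"
      unfolding w_def P_def using sub by (auto intro: card_Diff_subset card_mono)
    then show ?thesis by (simp add: of_nat_diff)
  qed
  also have "(\<Sum>x\<in>W. sgn_bit (qform p x)) = of_nat w"
    using sing by (simp add: w_def)
  finally have T: "(- 1) ^ elliptic_letters p * 2 ^ CARD('n) = 2 * of_nat w - (of_nat P :: complex)"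
    using sum_sgn_qform_perp[OF W sing] by (simp add: sum_sgn_qform)
  show ?thesis
  proof (cases "even (elliptic_letters p)")
    case True
    with T have "(of_nat (2 ^ CARD('n) + P) :: complex) = of_nat (2 * w)" by simp
    then have "2 ^ CARD('n) + P = 2 * w" by (simp only: of_nat_eq_iff)
    \<comment> \<open>Multiplying by \<open>w\<close> eliminates \<open>P\<close> through
      \<open>wP\<close>.\<close>
    then have "w * (2 ^ CARD('n) + P) = w * (2 * w)" by (simp only:)
    then have "w * 2 ^ CARD('n) + 2 ^ CARD('n) * 2 ^ CARD('n) = 2 * (w * w)"
      by (simp only: distrib_left wP mult.left_commute)
    then have "w = 2 ^ CARD('n)" by (rule quadratic_nat_roots[rotated]) simp
    then have "Max D = CARD('n)" by (simp add: w)
    then show ?thesis using True by (simp add: witt_index_def D_def)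
  next
    case False
    with T have "(of_nat P :: complex) = of_nat (2 * w + 2 ^ CARD('n))"
      by (simp add: algebra_simps)
    then have "P = 2 * w + 2 ^ CARD('n)" by (simp only: of_nat_eq_iff)
    then have "2 * (w * w) + w * 2 ^ CARD('n) = 2 ^ CARD('n) * 2 ^ CARD('n)"
      using wP by (simp only: distrib_left mult.left_commute)
    then have "2 * w = 2 ^ CARD('n)" by (rule quadratic_nat_roots[rotated]) simp
    then have "(2::nat) ^ Suc (Max D) = 2 ^ CARD('n)" by (simp add: w)
    \<comment> \<open>N is a successor here, so the truncated subtraction in the statement is
      exact.\<close>
    then have "Suc (Max D) = CARD('n)" by (subst (asm) power_inject_exp) simp_all
    then show ?thesis using False by (simp add: witt_index_def D_def)
  qed
qed

subsection \<open>Counting lines by pairs of points\<close>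

text \<open>
  The pairs with $a = 0$, $b = 0$ or $a = b$ span no line, but their product of observables is positive and
  they are not affected by flips, so that they may be kept in the sums over pairs.
\<close>

definition orthogonal_pairs :: "'n::finite symplectic_vec \<Rightarrow> ('n symplectic_vec \<times> 'n symplectic_vec) set" where
  "orthogonal_pairs p = {(a, b). qform p a = 0 \<and> qform p b = 0 \<and> symp a b = 0}"

definition spanning_pairs :: "'n::finite symplectic_vec \<Rightarrow> ('n symplectic_vec \<times> 'n symplectic_vec) set" where
  "spanning_pairs p = {(a, b) \<in> orthogonal_pairs p. a \<noteq> 0 \<and> b \<noteq> 0 \<and> a \<noteq> b}"

lemma bit_vec_add_eq_0_iff: "x + y = 0 \<longleftrightarrow> x = (y :: bit ^ 'm)"
  by (metis add.right_neutral bit_vec_add_self bit_vec_add_self_left)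

lemma lines_in_quadric:
  "lines_in (quadric_of (qform p)) = (\<lambda>(a, b). {a, b, a + b}) ` spanning_pairs p"
proof -
  \<comment> \<open>The form is additive on orthogonal pairs, so the third point is singular once
    the first two are.\<close>
  have sub: "{a, b, a + b} \<subseteq> quadric_of (qform p) \<longleftrightarrow> qform p a = 0 \<and> qform p b = 0"
    if "a \<noteq> 0" "b \<noteq> 0" "a \<noteq> b" "symp a b = 0" for a b
    using that by (auto simp: quadric_of_def points_def qform_add bit_vec_add_eq_0_iff)
  have "l \<in> lines_in (quadric_of (qform p)) \<longleftrightarrow>
      (\<exists>a b. (a, b) \<in> spanning_pairs p \<and> l = {a, b, a + b})" for l
  proof -
    have "l \<in> lines_in (quadric_of (qform p)) \<longleftrightarrow>
      (\<exists>a b. (a \<noteq> 0 \<and> b \<noteq> 0 \<and> a \<noteq> b \<and> symp a b = 0 \<and> {a, b, a + b} \<subseteq> quadric_of (qform p))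
         \<and> l = {a, b, a + b})"
      unfolding lines_in_def lines_def points_def by blast
    also have "\<dots> \<longleftrightarrow> (\<exists>a b. (a, b) \<in> spanning_pairs p \<and> l = {a, b, a + b})"
      using sub by (intro ex_cong1) (auto simp: spanning_pairs_def orthogonal_pairs_def)
    finally show ?thesis .
  qed
  then show ?thesis by (auto simp: image_iff Bex_def)
qed

text \<open>Any two of the three points determine the line, which leaves six ordered pairs.\<close>

lemma card_pairs_of_line:
  assumes "l \<in> lines_in (quadric_of (qform p))"
  shows "card {x \<in> spanning_pairs p. (\<lambda>(a, b). {a, b, a + b}) x = l} = 6"
proof -
  from assms obtain a b where ab: "(a, b) \<in> spanning_pairs p" and l: "l = {a, b, a + b}"
    by (auto simp: lines_in_quadric)
  have ne: "a \<noteq> b" "a \<noteq> a + b" "b \<noteq> a + b" "a + b \<noteq> 0"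
    using ab by (auto simp: spanning_pairs_def bit_vec_add_eq_0_iff)
  have cancel: "a + (a + b) = b" "b + (a + b) = a" "a + b + a = b" "a + b + b = a" "b + a = a + b"
    by (simp_all add: ac_simps)
  define P where "P = {(a, b), (b, a), (a, a + b), (a + b, a), (b, a + b), (a + b, b)}"
  have "{x \<in> spanning_pairs p. (\<lambda>(a, b). {a, b, a + b}) x = l} = P"
  proof (intro equalityI subsetI)
    fix x assume "x \<in> {x \<in> spanning_pairs p. (\<lambda>(a, b). {a, b, a + b}) x = l}"
    then have "fst x \<in> l" "snd x \<in> l" "fst x \<noteq> snd x"
      by (auto simp: spanning_pairs_def split: prod.splits)
    then show "x \<in> P" by (cases x) (auto simp: P_def l)
  next
    fix x assume "x \<in> P"
    then show "x \<in> {x \<in> spanning_pairs p. (\<lambda>(a, b). {a, b, a + b}) x = l}"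
      using ab ne
      by (auto simp: P_def l spanning_pairs_def orthogonal_pairs_def qform_add symp_add_left
          symp_add_right symp_commute[of b a] cancel)
  qed
  moreover have "card P = 6" using ne by (auto simp: P_def)
  ultimately show ?thesis by simp
qed

lemma sum_spanning_pairs:
  fixes f :: "'n::finite symplectic_vec set \<Rightarrow> complex"
  shows "(\<Sum>(a, b)\<in>spanning_pairs p. f {a, b, a + b}) = 6 * (\<Sum>l\<in>lines_in (quadric_of (qform p)). f l)"
proof -
  let ?g = "\<lambda>(a, b). {a, b, a + b} :: 'n symplectic_vec set"
  have "(\<Sum>(a, b)\<in>spanning_pairs p. f {a, b, a + b}) = (\<Sum>x\<in>spanning_pairs p. f (?g x))"
    by (simp add: case_prod_beta)
  also have "\<dots> = (\<Sum>l\<in>lines_in (quadric_of (qform p)). \<Sum>x\<in>{x \<in> spanning_pairs p. ?g x = l}. f (?g x))"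
    by (rule sum.group[symmetric]) (auto simp: lines_in_quadric)
  also have "\<dots> = (\<Sum>l\<in>lines_in (quadric_of (qform p)). 6 * f l)"
  proof (rule sum.cong)
    fix l assume "l \<in> lines_in (quadric_of (qform p))"
    from card_pairs_of_line[OF this]
    show "(\<Sum>x\<in>{x \<in> spanning_pairs p. ?g x = l}. f (?g x)) = 6 * f l" by simp
  qed simp
  finally show ?thesis by (simp add: sum_distrib_left)
qed

text \<open>A line with property \<open>R\<close> is met by 6 ordered pairs, each contributing 1 -
  (-1) = 2; all other pairs contribute 0.\<close>

lemma card_lines_by_pairs:
  fixes \<psi> :: "'n::finite symplectic_vec \<Rightarrow> 'n symplectic_vec \<Rightarrow> complex"
  assumes spanning: "\<And>a b. (a, b) \<in> spanning_pairs p \<Longrightarrow> \<psi> a b = (if R {a, b, a + b} then - 1 else 1)"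
    and degenerate: "\<And>a. \<psi> 0 a = 1" "\<And>a. \<psi> a 0 = 1" "\<And>a. \<psi> a a = 1"
  shows "12 * of_nat (card {l \<in> lines_in (quadric_of (qform p)). R l})
       = (\<Sum>(a, b)\<in>orthogonal_pairs p. 1 - \<psi> a b)"
proof -
  have "(\<Sum>(a, b)\<in>orthogonal_pairs p. 1 - \<psi> a b) = (\<Sum>(a, b)\<in>spanning_pairs p. 1 - \<psi> a b)"
    by (rule sum.mono_neutral_right) (auto simp: spanning_pairs_def degenerate)
  also have "\<dots> = (\<Sum>(a, b)\<in>spanning_pairs p. if R {a, b, a + b} then 2 else 0)"
    by (rule sum.cong) (auto simp: spanning)
  also have "\<dots> = 6 * (\<Sum>l\<in>lines_in (quadric_of (qform p)). if R l then 2 else 0)"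
    by (rule sum_spanning_pairs)
  also have "(\<Sum>l\<in>lines_in (quadric_of (qform p)). if R l then 2 else 0)
      = 2 * (of_nat (card {l \<in> lines_in (quadric_of (qform p)). R l}) :: complex)"
    by (simp add: sum.If_cases Collect_conj_eq)
  finally show ?thesis by simp
qed

lemma negative_line_spanning_pair:
  assumes "(a, b) \<in> spanning_pairs p"
  shows "phase a b = (if negative_line {a, b, a + b} then - 1 else 1)"
  using assms phase_cases[of a b] negative_line_iff[of a b]
  by (auto simp: spanning_pairs_def orthogonal_pairs_def)

lemma card_negative_lines_pairs:
  "12 * of_nat (card (negative_lines_in (quadric_of (qform p))))
     = (\<Sum>(a, b)\<in>orthogonal_pairs p. 1 - phase a b)"
  unfolding negative_lines_in_def
  by (rule card_lines_by_pairs) (simp_all add: negative_line_spanning_pair)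

definition flip_sign :: "'a set \<Rightarrow> 'a \<Rightarrow> complex" where
  "flip_sign T x = (if x \<in> T then - 1 else 1)"

text \<open>Taking the indicator of \<open>T\<close> as the assignment, a line is violated exactly
  when its phase times its three flip signs is -1. As 0 is not flipped, degenerate pairs keep sign
  product 1.\<close>

lemma quadric_degree_le:
  fixes p :: "'n::finite symplectic_vec"
  assumes "0 \<notin> T"
  shows "\<exists>d. quadric_degree (quadric_of (qform p)) \<le> d \<and>
    12 * of_nat d = (\<Sum>(a, b)\<in>orthogonal_pairs p.
       1 - phase a b * (flip_sign T a * flip_sign T b * flip_sign T (a + b)))"
proof -
  let ?S = "quadric_of (qform p)"
  define v :: "'n symplectic_vec \<Rightarrow> bit" where "v = (\<lambda>x. if x \<in> T then 1 else 0)"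
  define w where "w c = (\<Sum>x\<in>?S. incidence c x * v x)" for c
  define d where "d = hamming_dist (lines_in ?S) valuation w"
  have "w \<in> incidence_image ?S"
    unfolding incidence_image_def w_def by blast
  then have "quadric_degree ?S \<le> d"
    unfolding quadric_degree_def contextuality_degree_def d_def by (intro cINF_lower) auto
  moreover have "12 * of_nat d = (\<Sum>(a, b)\<in>orthogonal_pairs p.
       1 - phase a b * (flip_sign T a * flip_sign T b * flip_sign T (a + b)))"
    unfolding d_def hamming_dist_def
  proof (rule card_lines_by_pairs)
    fix a b assume ab: "(a, b) \<in> spanning_pairs p"
    then have "{a, b, a + b} \<in> lines_in ?S" by (auto simp: lines_in_quadric)
    then have sub: "{a, b, a + b} \<subseteq> ?S" by (simp add: lines_in_def)
    have "w {a, b, a + b} = (\<Sum>x\<in>{a, b, a + b}. v x)"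
      unfolding w_def by (rule sum.mono_neutral_cong_right) (use sub in \<open>auto simp: incidence_def\<close>)
    also have "\<dots> = v a + v b + v (a + b)"
      using ab by (simp add: spanning_pairs_def add.assoc)
    finally have w: "w {a, b, a + b} = v a + v b + v (a + b)" .
    show "phase a b * (flip_sign T a * flip_sign T b * flip_sign T (a + b))
        = (if valuation {a, b, a + b} \<noteq> w {a, b, a + b} then - 1 else 1)"
      unfolding w negative_line_spanning_pair[OF ab] valuation_def
      by (simp add: flip_sign_def v_def)
  qed (use assms in \<open>auto simp: flip_sign_def\<close>)
  ultimately show ?thesis by blast
qed

subsection \<open>Character sums\<close>

lemma sum_UNIV_bit: "(\<Sum>s\<in>UNIV. f s) = f 0 + f (1 :: bit)" for f :: "bit \<Rightarrow> 'a::comm_monoid_add"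
  by (simp add: UNIV_bit)

lemma indicator_eq_char_sum: "(if q = 0 then 1 else 0) = (\<Sum>s\<in>UNIV. sgn_bit (s * q)) / 2"
  by (simp add: sum_UNIV_bit)

lemma sgn_mult_qform:
  "sgn_bit (s * qform p a) = (\<Prod>j\<in>UNIV. sgn_bit (s * qform_letter (letter p j) (letter a j)))"
  by (simp add: qform_def sum_distrib_left sgn_bit_sum)

lemma sgn_mult_symp:
  "sgn_bit (s * symp a b) = (\<Prod>j\<in>UNIV. sgn_bit (s * symp_letter (letter a j) (letter b j)))"
  by (simp add: symp_letters sum_distrib_left sgn_bit_sum)

text \<open>The one-qubit factor of a sum over orthogonal pairs: \<open>s\<close>, \<open>t\<close>,
  \<open>r\<close> are dual to the conditions Q_p(a) = 0, Q_p(b) = 0, <a|b> = 0. Each condition is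
  half a character sum, whence the denominator 8 below.\<close>

definition pair_char_sum ::
  "(bit \<times> bit \<Rightarrow> bit \<times> bit \<Rightarrow> complex) \<Rightarrow> bit \<times> bit \<Rightarrow> bit \<Rightarrow> bit \<Rightarrow> bit \<Rightarrow> complex" where
  "pair_char_sum f m s t r = (\<Sum>k\<in>UNIV. \<Sum>l\<in>UNIV.
     sgn_bit (s * qform_letter m k) * sgn_bit (t * qform_letter m l) * sgn_bit (r * symp_letter k l) * f k l)"

lemma sum_orthogonal_pairs:
  fixes p :: "'n::finite symplectic_vec"
  shows "(\<Sum>(a, b)\<in>orthogonal_pairs p. \<Prod>j\<in>UNIV. f (letter a j) (letter b j))
       = (\<Sum>s\<in>UNIV. \<Sum>t\<in>UNIV. \<Sum>r\<in>UNIV. \<Prod>j\<in>UNIV. pair_char_sum f (letter p j) s t r) / 8"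
proof -
  define F where "F a b = (\<Prod>j\<in>UNIV. f (letter a j) (letter b j))" for a b :: "'n symplectic_vec"
  have "(\<Sum>(a, b)\<in>orthogonal_pairs p. F a b)
      = (\<Sum>(a, b)\<in>UNIV. if qform p a = 0 \<and> qform p b = 0 \<and> symp a b = 0 then F a b else 0)"
    by (rule sum.mono_neutral_cong_left) (auto simp: orthogonal_pairs_def split: if_splits)
  also have "\<dots> = (\<Sum>a\<in>UNIV. \<Sum>b\<in>UNIV. (if qform p a = 0 then 1 else 0) *
      (if qform p b = 0 then 1 else 0) * (if symp a b = 0 then 1 else 0) * F a b)"
    unfolding sum.cartesian_product UNIV_Times_UNIV by (rule sum.cong) auto
  also have "\<dots> = (\<Sum>a\<in>UNIV. \<Sum>b\<in>UNIV. \<Sum>s\<in>UNIV. \<Sum>t\<in>UNIV. \<Sum>r\<in>UNIV.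
      sgn_bit (s * qform p a) * sgn_bit (t * qform p b) * sgn_bit (r * symp a b) * F a b / 8)"
    by (simp only: indicator_eq_char_sum sum_UNIV_bit) (simp add: algebra_simps add_divide_distrib)
  also have "\<dots> = (\<Sum>s\<in>UNIV. \<Sum>t\<in>UNIV. \<Sum>r\<in>UNIV. (\<Sum>a\<in>UNIV. \<Sum>b\<in>UNIV.
      sgn_bit (s * qform p a) * sgn_bit (t * qform p b) * sgn_bit (r * symp a b) * F a b)) / 8"
    by (simp only: sum_UNIV_bit sum.distrib add_divide_distrib sum_divide_distrib)
  also have "(\<lambda>s t r. \<Sum>a\<in>UNIV. \<Sum>b\<in>UNIV.
        sgn_bit (s * qform p a) * sgn_bit (t * qform p b) * sgn_bit (r * symp a b) * F a b)
      = (\<lambda>s t r. \<Prod>j\<in>UNIV. pair_char_sum f (letter p j) s t r)"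
    unfolding pair_char_sum_def F_def sgn_mult_qform sgn_mult_symp
    by (simp flip: prod.distrib) (subst sum_sum_prod_letter, rule refl)
  finally show ?thesis by (simp add: F_def)
qed

text \<open>For (1, 1, 1) the exponent is Q(k) + Q(l) + <k|l> = Q(k + l), so, as for (1, 0, 0) and
  (0, 1, 0), the value is 4 times a Gauss sum 2 or -2. For (1, 1, 0) it is the square of that sum;
  for the other triples with r = 1 orthogonality of characters leaves one identity letter.\<close>

lemma pair_char_sum_one:
  "pair_char_sum (\<lambda>_ _. 1) m s t r =
     (if s = 0 \<and> t = 0 \<and> r = 0 then 16
      else if (s, t, r) \<in> {(0, 1, 0), (1, 0, 0), (1, 1, 1)} then (if m = (1, 1) then - 8 else 8)
      else 4)"
  by (cases m rule: letter_cases; cases s; cases t; cases r)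
     (simp_all add: pair_char_sum_def sum_letter qform_letter_def symp_letter_def)

text \<open>The phases i and -i of anticommuting letters cancel, so \<open>r\<close> has no effect
  and only the ten commuting pairs count, with signs given by \<open>s\<close> and
  \<open>t\<close>.\<close>

lemma pair_char_sum_phase:
  "pair_char_sum phase_letter m s t r =
     (if s = 0 \<and> t = 0 then 10 else if m = (1, 1) then - 2 else 6)"
  by (cases m rule: letter_cases; cases s; cases t; cases r)
     (simp_all add: pair_char_sum_def sum_letter qform_letter_def symp_letter_def phase_letter_def zero_prod_def)

text \<open>Of the eight triples one contributes 16^N, three contribute 8^N up to sign, and four
  contribute 4^N.\<close>

lemma card_orthogonal_pairs:
  fixes p :: "'n::finite symplectic_vec"
  defines "N \<equiv> CARD('n)"
  shows "8 * of_nat (card (orthogonal_pairs p)) =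
    (16 ^ N + 4 * 4 ^ N + 3 * (- 1) ^ elliptic_letters p * 8 ^ N :: complex)"
proof -
  have "(- 8) ^ elliptic_letters p * 8 ^ (N - elliptic_letters p)
      = ((- 1) ^ elliptic_letters p * 8 ^ N :: complex)"
    using elliptic_letters_le[of p] unfolding N_def
    by (simp add: power_minus[of 8] mult.assoc flip: power_add)
  then show ?thesis
    using sum_orthogonal_pairs[of "\<lambda>_ _. 1" p]
    by (simp add: sum_UNIV_bit pair_char_sum_one prod_elliptic_letters N_def ac_simps)
qed

text \<open>Two of the eight triples have s = t = 0, which explains the coefficients 2 and
  6.\<close>

lemma sum_phase_orthogonal_pairs:
  fixes p :: "'n::finite symplectic_vec"
  defines "N \<equiv> CARD('n)"
  shows "8 * (\<Sum>(a, b)\<in>orthogonal_pairs p. phase a b)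
       = 2 * 10 ^ N + 6 * (- 2) ^ elliptic_letters p * 6 ^ (N - elliptic_letters p)"
  using sum_orthogonal_pairs[of phase_letter p]
  by (simp add: sum_UNIV_bit pair_char_sum_phase prod_elliptic_letters N_def ac_simps flip: phase_def)

text \<open>The factor 96 is 12 from the weighted pairs of a line times 8 from the
  characters.\<close>

theorem card_negative_lines_in_quadric:
  fixes p :: "'n::finite symplectic_vec"
  defines "N \<equiv> CARD('n)"
  shows "96 * of_nat (card (negative_lines_in (quadric_of (qform p)))) =
    (16 ^ N + 4 * 4 ^ N + 3 * (- 1) ^ elliptic_letters p * 8 ^ N
     - (2 * 10 ^ N + 6 * (- 2) ^ elliptic_letters p * 6 ^ (N - elliptic_letters p)) :: complex)"
proof -
  let ?n = "of_nat (card (negative_lines_in (quadric_of (qform p)))) :: complex"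
  have "12 * ?n = of_nat (card (orthogonal_pairs p)) - (\<Sum>(a, b)\<in>orthogonal_pairs p. phase a b)"
    by (simp add: card_negative_lines_pairs case_prod_beta sum_subtractf)
  moreover have "96 * ?n = 8 * (12 * ?n)" by simp
  ultimately show ?thesis
    unfolding N_def by (simp only: right_diff_distrib card_orthogonal_pairs sum_phase_orthogonal_pairs)
qed

subsection \<open>Flipping a set of points\<close>

text \<open>With \<open>a\<close> fixed, two conditions on \<open>b\<close> remain, hence the
  denominator 4.\<close>

lemma sum_phase_row:
  fixes p a :: "'n::finite symplectic_vec"
  shows "(\<Sum>b | qform p b = 0 \<and> symp a b = 0. phase a b)
       = (\<Sum>s\<in>UNIV. \<Sum>r\<in>UNIV. \<Prod>j\<in>UNIV. \<Sum>l\<in>UNIV.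
            sgn_bit (s * qform_letter (letter p j) l) * sgn_bit (r * symp_letter (letter a j) l)
              * phase_letter (letter a j) l) / 4"
proof -
  have "(\<Sum>b | qform p b = 0 \<and> symp a b = 0. phase a b)
      = (\<Sum>b\<in>UNIV. if qform p b = 0 \<and> symp a b = 0 then phase a b else 0)"
    by (rule sum.mono_neutral_cong_left) (auto split: if_splits)
  also have "\<dots> = (\<Sum>b\<in>UNIV. (if qform p b = 0 then 1 else 0) * (if symp a b = 0 then 1 else 0) * phase a b)"
    by (rule sum.cong) auto
  also have "\<dots> = (\<Sum>b\<in>UNIV. \<Sum>s\<in>UNIV. \<Sum>r\<in>UNIV.
      sgn_bit (s * qform p b) * sgn_bit (r * symp a b) * phase a b / 4)"
    by (simp only: indicator_eq_char_sum sum_UNIV_bit) (simp add: algebra_simps add_divide_distrib)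
  also have "\<dots> = (\<Sum>s\<in>UNIV. \<Sum>r\<in>UNIV. (\<Sum>b\<in>UNIV.
      sgn_bit (s * qform p b) * sgn_bit (r * symp a b) * phase a b)) / 4"
    by (simp only: sum_UNIV_bit sum.distrib add_divide_distrib sum_divide_distrib)
  also have "(\<lambda>s r. \<Sum>b\<in>UNIV. sgn_bit (s * qform p b) * sgn_bit (r * symp a b) * phase a b)
      = (\<lambda>s r. \<Prod>j\<in>UNIV. \<Sum>l\<in>UNIV.
            sgn_bit (s * qform_letter (letter p j) l) * sgn_bit (r * symp_letter (letter a j) l)
              * phase_letter (letter a j) l)"
    unfolding phase_def sgn_mult_qform sgn_mult_symp
    by (simp flip: prod.distrib)
       (subst sum_prod_letter[of "\<lambda>j l. sgn_bit (_ * qform_letter (letter p j) l) *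
          sgn_bit (_ * symp_letter (letter a j) l) * phase_letter (letter a j) l"], rule refl)
  finally show ?thesis .
qed

text \<open>The swap and the shear (a, b) -> (a, a + b) preserve orthogonal pairs and phases, and
  together generate all permutations of the three points of a line.\<close>

lemma orthogonal_pairs_reindex:
  fixes g :: "'n::finite symplectic_vec \<Rightarrow> 'n symplectic_vec \<Rightarrow> complex"
  shows "(\<Sum>(a, b)\<in>orthogonal_pairs p. phase a b * g b a) = (\<Sum>(a, b)\<in>orthogonal_pairs p. phase a b * g a b)"
    and "(\<Sum>(a, b)\<in>orthogonal_pairs p. phase a b * g a (a + b)) = (\<Sum>(a, b)\<in>orthogonal_pairs p. phase a b * g a b)"
proof -
  show "(\<Sum>(a, b)\<in>orthogonal_pairs p. phase a b * g b a) = (\<Sum>(a, b)\<in>orthogonal_pairs p. phase a b * g a b)"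
    by (rule sum.reindex_bij_witness[of _ "\<lambda>(a, b). (b, a)" "\<lambda>(a, b). (b, a)"])
       (auto simp: orthogonal_pairs_def phase_swap symp_commute)
  show "(\<Sum>(a, b)\<in>orthogonal_pairs p. phase a b * g a (a + b)) = (\<Sum>(a, b)\<in>orthogonal_pairs p. phase a b * g a b)"
    by (rule sum.reindex_bij_witness[of _ "\<lambda>(a, b). (a, a + b)" "\<lambda>(a, b). (a, a + b)"])
       (auto simp: orthogonal_pairs_def phase_add symp_add_right qform_add)
qed

text \<open>
  With $t$ the indicator function of \<open>T\<close>, the product of the three signs of a line expands into
  monomials in $t(a)$, $t(b)$, $t(a+b)$. The summation is invariant under permuting $a$, $b$, $a+b$, so
  only $t(a)$, $t(a)t(b)$ and $t(a)t(b)t(a+b)$ remain, with coefficients $-6$, $12$ and $-8$.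
\<close>

lemma sum_flip_sign:
  fixes p :: "'n::finite symplectic_vec"
  assumes T: "\<And>x. x \<in> T \<Longrightarrow> qform p x = 0"
  shows "(\<Sum>(a, b)\<in>orthogonal_pairs p. phase a b * (flip_sign T a * flip_sign T b * flip_sign T (a + b)))
       = (\<Sum>(a, b)\<in>orthogonal_pairs p. phase a b)
         - 6 * (\<Sum>a\<in>T. \<Sum>b | qform p b = 0 \<and> symp a b = 0. phase a b)
         + (\<Sum>a\<in>T. \<Sum>b\<in>T. if symp a b = 0 then phase a b * (if a + b \<in> T then 4 else 12) else 0)"
proof -
  define t :: "'n symplectic_vec \<Rightarrow> complex" where "t x = (if x \<in> T then 1 else 0)" for x
  let ?S = "\<lambda>g. \<Sum>(a, b)\<in>orthogonal_pairs p. phase a b * g a b"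
  have flip: "flip_sign T x = 1 - 2 * t x" for x by (simp add: flip_sign_def t_def)
  have A: "?S (\<lambda>a b. t a) = (\<Sum>a\<in>T. \<Sum>b | qform p b = 0 \<and> symp a b = 0. phase a b)"
  proof -
    have "?S (\<lambda>a b. t a) = (\<Sum>(a, b)\<in>(SIGMA a:T. {b. qform p b = 0 \<and> symp a b = 0}). phase a b)"
      by (rule sum.mono_neutral_cong_right) (auto simp: orthogonal_pairs_def t_def T split: if_splits)
    then show ?thesis by (simp add: sum.Sigma)
  qed
  have B: "?S (\<lambda>a b. t a * t b * (12 - 8 * t (a + b)))
      = (\<Sum>a\<in>T. \<Sum>b\<in>T. if symp a b = 0 then phase a b * (if a + b \<in> T then 4 else 12) else 0)"
  proof -
    have "?S (\<lambda>a b. t a * t b * (12 - 8 * t (a + b)))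
        = (\<Sum>(a, b)\<in>T \<times> T. if symp a b = 0 then phase a b * (if a + b \<in> T then 4 else 12) else 0)"
      by (rule sum.mono_neutral_cong) (auto simp: orthogonal_pairs_def t_def T split: if_splits)
    then show ?thesis by (simp add: sum.cartesian_product)
  qed
  have A2: "?S (\<lambda>a b. t b) = ?S (\<lambda>a b. t a)"
    using orthogonal_pairs_reindex(1)[where p = p and g = "\<lambda>a b. t a"] .
  have A3: "?S (\<lambda>a b. t (a + b)) = ?S (\<lambda>a b. t a)"
    using orthogonal_pairs_reindex(2)[where p = p and g = "\<lambda>a b. t b"] A2 by simp
  have B2: "?S (\<lambda>a b. t a * t (a + b)) = ?S (\<lambda>a b. t a * t b)"
    using orthogonal_pairs_reindex(2)[where p = p and g = "\<lambda>a b. t a * t b"] .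
  have B3: "?S (\<lambda>a b. t b * t (a + b)) = ?S (\<lambda>a b. t a * t b)"
    using orthogonal_pairs_reindex(1)[where p = p and g = "\<lambda>a b. t a * t (a + b)"] B2 by (simp add: add.commute)
  have "?S (\<lambda>a b. flip_sign T a * flip_sign T b * flip_sign T (a + b))
      = ?S (\<lambda>a b. 1 - 2 * t a - 2 * t b - 2 * t (a + b)
          + 4 * (t a * t b) + 4 * (t a * t (a + b)) + 4 * (t b * t (a + b)) - 8 * (t a * t b * t (a + b)))"
    unfolding flip by (intro sum.cong refl) (auto simp: algebra_simps)
  also have "\<dots> = ?S (\<lambda>a b. 1) - 2 * ?S (\<lambda>a b. t a) - 2 * ?S (\<lambda>a b. t b) - 2 * ?S (\<lambda>a b. t (a + b))
      + 4 * ?S (\<lambda>a b. t a * t b) + 4 * ?S (\<lambda>a b. t a * t (a + b)) + 4 * ?S (\<lambda>a b. t b * t (a + b))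
      - 8 * ?S (\<lambda>a b. t a * t b * t (a + b))"
    by (simp add: case_prod_beta algebra_simps sum.distrib sum_subtractf sum_distrib_left)
  also have "\<dots> = ?S (\<lambda>a b. 1) - 6 * ?S (\<lambda>a b. t a) + (12 * ?S (\<lambda>a b. t a * t b)
      - 8 * ?S (\<lambda>a b. t a * t b * t (a + b)))"
    unfolding A2 A3 B2 B3 by simp
  also have "12 * ?S (\<lambda>a b. t a * t b) - 8 * ?S (\<lambda>a b. t a * t b * t (a + b))
      = ?S (\<lambda>a b. t a * t b * (12 - 8 * t (a + b)))"
    by (simp add: case_prod_beta algebra_simps sum.distrib sum_subtractf sum_distrib_left)
  finally show ?thesis unfolding A B by simp
qed

subsection \<open>Four qubits\<close>

abbreviation lI :: "bit \<times> bit" where "lI \<equiv> (0, 0)"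
abbreviation lX :: "bit \<times> bit" where "lX \<equiv> (0, 1)"
abbreviation lY :: "bit \<times> bit" where "lY \<equiv> (1, 1)"
abbreviation lZ :: "bit \<times> bit" where "lZ \<equiv> (1, 0)"

definition word4 ::
  "bit \<times> bit \<Rightarrow> bit \<times> bit \<Rightarrow> bit \<times> bit \<Rightarrow> bit \<times> bit \<Rightarrow> 4 symplectic_vec" where
  "word4 a b c d = word (\<lambda>j. if j = 1 then a else if j = 2 then b else if j = 3 then c else d)"

lemma prod_4: "(\<Prod>j\<in>UNIV. f j) = f 1 * f 2 * f 3 * f (4 :: 4)" for f :: "4 \<Rightarrow> 'a::comm_monoid_mult"
  unfolding UNIV_4 by (simp add: ac_simps)

lemma letter_word4 [simp]:
  "letter (word4 a b c d) 1 = a" "letter (word4 a b c d) 2 = b"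
  "letter (word4 a b c d) 3 = c" "letter (word4 a b c d) 4 = d"
  by (simp_all add: word4_def)

lemma symplectic_vec_eq_iff: "x = y \<longleftrightarrow> letter x = letter y"
  by (metis word_letter)

lemma word4_eq_iff: "x = word4 a b c d \<longleftrightarrow> letter x 1 = a \<and> letter x 2 = b \<and> letter x 3 = c \<and> letter x 4 = d"
  by (simp add: symplectic_vec_eq_iff fun_eq_iff forall_4)

lemma word4_inject [simp]:
  "word4 a b c d = word4 a' b' c' d' \<longleftrightarrow> a = a' \<and> b = b' \<and> c = c' \<and> d = d'"
  by (simp add: word4_eq_iff)

lemma zero_eq_word4 [simp]: "0 = word4 a b c d \<longleftrightarrow> lI = a \<and> lI = b \<and> lI = c \<and> lI = d"
  by (simp add: word4_eq_iff zero_prod_def)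

lemma word4_add [simp]: "word4 a b c d + word4 a' b' c' d' = word4 (a + a') (b + b') (c + c') (d + d')"
  by (simp add: word4_eq_iff letter_add)

lemma symp_word4 [simp]:
  "symp (word4 a b c d) (word4 a' b' c' d')
     = symp_letter a a' + symp_letter b b' + symp_letter c c' + symp_letter d d'"
  by (simp add: symp_letters sum_4)

lemma phase_word4 [simp]:
  "phase (word4 a b c d) (word4 a' b' c' d')
     = phase_letter a a' * phase_letter b b' * phase_letter c c' * phase_letter d d'"
  by (simp add: phase_def prod_4)

lemma qform_word4 [simp]:
  "qform (word4 a b c d) (word4 a' b' c' d')
     = qform_letter a a' + qform_letter b b' + qform_letter c c' + qform_letter d d'"
  by (simp add: qform_def sum_4)

lemma elliptic_letters_word4 [simp]:
  "elliptic_letters (word4 a b c d) = of_bool (a = lY) + of_bool (b = lY) + of_bool (c = lY) + of_bool (d = lY)"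
proof -
  have "elliptic_letters (word4 a b c d) = (\<Sum>j\<in>UNIV. of_bool (letter (word4 a b c d) j = lY))"
    by (simp add: elliptic_letters_def of_bool_def sum.If_cases)
  then show ?thesis by (simp add: sum_4)
qed

lemma phase_letter_table [simp]:
  "phase_letter lI l = 1" "phase_letter l lI = 1" "phase_letter l l = 1"
  "phase_letter lX lY = \<i>" "phase_letter lY lZ = \<i>" "phase_letter lZ lX = \<i>"
  "phase_letter lY lX = - \<i>" "phase_letter lZ lY = - \<i>" "phase_letter lX lZ = - \<i>"
  by (simp_all add: phase_letter_def zero_prod_def)

lemma symp_letter_table [simp]:
  "symp_letter lI l = 0" "symp_letter l lI = 0" "symp_letter l l = 0"
  "symp_letter lX lY = 1" "symp_letter lY lZ = 1" "symp_letter lZ lX = 1"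
  "symp_letter lY lX = 1" "symp_letter lZ lY = 1" "symp_letter lX lZ = 1"
  by (simp_all add: symp_letter_def mult.commute)

lemma qform_letter_table [simp]:
  "qform_letter m lI = 0"
  "qform_letter lI lX = 0" "qform_letter lI lZ = 0" "qform_letter lI lY = 1"
  "qform_letter lY lX = 1" "qform_letter lY lZ = 1" "qform_letter lY lY = 1"
  by (simp_all add: qform_letter_def)

lemma card_negative_lines_four_qubits:
  fixes p :: "4 symplectic_vec"
  shows "card (negative_lines_in (quadric_of (qform p))) = [532, 384, 604, 360, 612] ! elliptic_letters p"
proof -
  have "elliptic_letters p \<in> {0, 1, 2, 3, 4}"
    using elliptic_letters_le[of p] by auto
  moreover have "(96 :: complex) * of_nat (card (negative_lines_in (quadric_of (qform p))))
      = 96 * of_nat ([532, 384, 604, 360, 612] ! elliptic_letters p)"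
    using calculation by (auto simp: card_negative_lines_in_quadric)
  ultimately show ?thesis by (metis mult_cancel_left of_nat_eq_iff zero_neq_numeral)
qed

text \<open>Four times the sum of the phases of \<open>a\<close> with the singular vectors
  orthogonal to it. As 0 and \<open>a\<close> itself contribute 2 to that sum, flipping a single
  point \<open>a\<close> of the quadric changes the number of violated lines by
  \<open>flip_row p a / 8 - 1\<close>.\<close>

definition flip_row :: "4 symplectic_vec \<Rightarrow> 4 symplectic_vec \<Rightarrow> complex" where
  "flip_row p a = (\<Sum>s\<in>UNIV. \<Sum>r\<in>UNIV. \<Prod>j\<in>UNIV. \<Sum>l\<in>UNIV.
            sgn_bit (s * qform_letter (letter p j) l) * sgn_bit (r * symp_letter (letter a j) l)
              * phase_letter (letter a j) l)"

text \<open>With n negative lines the count of violated lines satisfies 12 d = 12 n + 6 (A / 4) - B;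
  doubling clears the denominator. \<open>T\<close> is a list so that its sums unfold by
  rewriting.\<close>

lemma quadric_degree_flip:
  fixes p :: "4 symplectic_vec"
  assumes T: "distinct T" "0 \<notin> set T" "\<forall>x\<in>set T. qform p x = 0"
    and rows: "(\<Sum>a\<leftarrow>T. flip_row p a) = of_int A"
    and pairs: "(\<Sum>a\<leftarrow>T. \<Sum>b\<leftarrow>T. if symp a b = 0 then phase a b * (if a + b \<in> set T then 4 else 12) else 0) = of_int B"
    and d: "24 * int (card (negative_lines_in (quadric_of (qform p)))) + 3 * A - 2 * B = 24 * int d"
  shows "quadric_degree (quadric_of (qform p)) \<le> d"
proof -
  let ?n = "card (negative_lines_in (quadric_of (qform p)))"
  obtain e where e: "quadric_degree (quadric_of (qform p)) \<le> e"
    and "12 * of_nat e = (\<Sum>(a, b)\<in>orthogonal_pairs p.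
       1 - phase a b * (flip_sign (set T) a * flip_sign (set T) b * flip_sign (set T) (a + b)))"
    using quadric_degree_le[OF T(2)] by blast
  then have "12 * of_nat e = of_nat (card (orthogonal_pairs p)) - (\<Sum>(a, b)\<in>orthogonal_pairs p.
       phase a b * (flip_sign (set T) a * flip_sign (set T) b * flip_sign (set T) (a + b)))"
    by (simp add: case_prod_beta sum_subtractf)
  also have "(\<Sum>(a, b)\<in>orthogonal_pairs p.
       phase a b * (flip_sign (set T) a * flip_sign (set T) b * flip_sign (set T) (a + b)))
      = (\<Sum>(a, b)\<in>orthogonal_pairs p. phase a b) - 6 * (of_int A / 4) + of_int B"
  proof -
    have "(\<Sum>a\<in>set T. \<Sum>b | qform p b = 0 \<and> symp a b = 0. phase a b) = of_int A / 4"
      using rows T(1)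
      by (simp add: sum_list_distinct_conv_sum_set sum_phase_row flip_row_def flip: sum_divide_distrib)
    moreover have "(\<Sum>a\<in>set T. \<Sum>b\<in>set T.
        if symp a b = 0 then phase a b * (if a + b \<in> set T then 4 else 12) else 0) = of_int B"
      using pairs T(1) by (simp add: sum_list_distinct_conv_sum_set)
    ultimately show ?thesis
      using sum_flip_sign[of "set T" p, OF bspec[OF T(3)]] by (simp only:)
  qed
  also have "of_nat (card (orthogonal_pairs p)) - ((\<Sum>(a, b)\<in>orthogonal_pairs p. phase a b) - 6 * (of_int A / 4) + of_int B)
      = 12 * (of_nat ?n :: complex) + 6 * (of_int A / 4) - of_int B"
    by (simp add: card_negative_lines_pairs case_prod_beta sum_subtractf)
  finally have "24 * (of_nat e :: complex) = of_int (24 * int ?n + 3 * A - 2 * B)"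
    by (simp add: field_simps)
  then have "(of_int (24 * int e) :: complex) = of_int (24 * int d)" 
    unfolding d by simp
  then have "e = d" unfolding of_int_eq_iff by simp
  with e show ?thesis by simp
qed

section \<open>Explicit flip sets for the five types\<close>

lemma quadric_degree_IIII: "quadric_degree (quadric_of (qform (word4 lI lI lI lI))) \<le> 498"
proof (rule quadric_degree_flip)
  \<comment> \<open>The set is invariant under exchanging X and Z. The rows of XXXX and ZZZZ are -96
    each, so either flip alone saves 13 lines; the other two rows are 0.\<close>
  let ?T = "[word4 lX lI lX lX, word4 lX lX lX lX, word4 lZ lI lZ lZ, word4 lZ lZ lZ lZ]"
  show "distinct ?T" "0 \<notin> set ?T" "\<forall>x\<in>set ?T. qform (word4 lI lI lI lI) x = 0"
    by simp_all
  show "(\<Sum>a\<leftarrow>?T. flip_row (word4 lI lI lI lI) a) = of_int (-192)"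
    by (simp add: flip_row_def sum_UNIV_bit prod_4 sum_letter, (simp add: algebra_simps)?)
  show "(\<Sum>a\<leftarrow>?T. \<Sum>b\<leftarrow>?T. if symp a b = 0 then phase a b * (if a + b \<in> set ?T then 4 else 12) else 0) = of_int (120)"
    by simp
  show "24 * int (card (negative_lines_in (quadric_of (qform (word4 lI lI lI lI))))) + 3 * (-192) - 2 * (120) = 24 * int 498"
    by (simp add: card_negative_lines_four_qubits)
qed

lemma quadric_degree_YIII: "quadric_degree (quadric_of (qform (word4 lY lI lI lI))) \<le> 362"
proof (rule quadric_degree_flip)
  \<comment> \<open>Where \<open>p\<close> has Y and the flipped word is not I, the terms with s = 1
    in its row vanish. The rows are 32 for the words beginning with Y or Z, 64 for IZYY and 0 for
    the other three.\<close>
  let ?T = "[word4 lI lX lZ lZ, word4 lI lZ lX lZ, word4 lI lZ lY lY, word4 lI lZ lZ lX,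
       word4 lY lX lX lY, word4 lY lX lY lX, word4 lY lY lX lX, word4 lZ lX lX lY]"
  show "distinct ?T" "0 \<notin> set ?T" "\<forall>x\<in>set ?T. qform (word4 lY lI lI lI) x = 0"
    by simp_all
  show "(\<Sum>a\<leftarrow>?T. flip_row (word4 lY lI lI lI) a) = of_int (192)"
    by (simp add: flip_row_def sum_UNIV_bit prod_4 sum_letter, (simp add: algebra_simps)?)
  show "(\<Sum>a\<leftarrow>?T. \<Sum>b\<leftarrow>?T. if symp a b = 0 then phase a b * (if a + b \<in> set ?T then 4 else 12) else 0) = of_int (552)"
    by simp
  show "24 * int (card (negative_lines_in (quadric_of (qform (word4 lY lI lI lI))))) + 3 * (192) - 2 * (552) = 24 * int 362"
    by (simp add: card_negative_lines_four_qubits)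
qed

lemma quadric_degree_YYII: "quadric_degree (quadric_of (qform (word4 lY lY lI lI))) \<le> 498"
proof (rule quadric_degree_flip)
  \<comment> \<open>No word has I at the two letters Y of \<open>p\<close>, so the terms with s = 1
    vanish: the row is 64 for the six words containing I and 32 for the other twelve.\<close>
  let ?T = "[word4 lX lX lI lZ, word4 lX lX lX lZ, word4 lX lX lZ lZ, word4 lX lY lY lY,
       word4 lX lZ lI lX, word4 lX lZ lX lX, word4 lX lZ lZ lX, word4 lY lY lI lX,
       word4 lY lY lX lX, word4 lY lZ lI lZ, word4 lY lZ lX lZ, word4 lY lZ lZ lZ,
       word4 lZ lX lI lX, word4 lZ lX lX lX, word4 lZ lX lZ lX, word4 lZ lY lI lZ,
       word4 lZ lY lX lZ, word4 lZ lY lZ lZ]"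
  show "distinct ?T" "0 \<notin> set ?T" "\<forall>x\<in>set ?T. qform (word4 lY lY lI lI) x = 0"
    by simp_all
  show "(\<Sum>a\<leftarrow>?T. flip_row (word4 lY lY lI lI) a) = of_int (768)"
    by (simp add: flip_row_def sum_UNIV_bit prod_4 sum_letter, (simp add: algebra_simps)?)
  show "(\<Sum>a\<leftarrow>?T. \<Sum>b\<leftarrow>?T. if symp a b = 0 then phase a b * (if a + b \<in> set ?T then 4 else 12) else 0) = of_int (2424)"
    by simp
  show "24 * int (card (negative_lines_in (quadric_of (qform (word4 lY lY lI lI))))) + 3 * (768) - 2 * (2424) = 24 * int 498"
    by (simp add: card_negative_lines_four_qubits)
qed

lemma quadric_degree_YYYI: "quadric_degree (quadric_of (qform (word4 lY lY lY lI))) \<le> 349"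
proof (rule quadric_degree_flip)
  \<comment> \<open>Every row is 32, so a single flip adds 3 violated lines. All words end in Y, so
    no sum of two lies in the set; the 16 unordered orthogonal pairs of distinct words have phase 1
    and save 2 lines each: 360 + 21 - 32 = 349.\<close>
  let ?T = "[word4 lX lX lX lY, word4 lX lY lZ lY, word4 lX lZ lY lY, word4 lY lY lY lY,
       word4 lZ lX lY lY, word4 lZ lY lX lY, word4 lZ lZ lZ lY]"
  show "distinct ?T" "0 \<notin> set ?T" "\<forall>x\<in>set ?T. qform (word4 lY lY lY lI) x = 0"
    by simp_all
  show "(\<Sum>a\<leftarrow>?T. flip_row (word4 lY lY lY lI) a) = of_int (224)"
    by (simp add: flip_row_def sum_UNIV_bit prod_4 sum_letter, (simp add: algebra_simps)?)
  show "(\<Sum>a\<leftarrow>?T. \<Sum>b\<leftarrow>?T. if symp a b = 0 then phase a b * (if a + b \<in> set ?T then 4 else 12) else 0) = of_int (468)"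
    by simp
  show "24 * int (card (negative_lines_in (quadric_of (qform (word4 lY lY lY lI))))) + 3 * (224) - 2 * (468) = 24 * int 349"
    by (simp add: card_negative_lines_four_qubits)
qed

lemma quadric_degree_YYYY: "quadric_degree (quadric_of (qform (word4 lY lY lY lY))) \<le> 517"
proof (rule quadric_degree_flip)
  \<comment> \<open>No word contains I, so again every row is 32 and a single flip costs 3 lines;
    the gain comes from lines that meet the set more than once.\<close>
  let ?T = "[word4 lX lX lX lY, word4 lY lX lX lX, word4 lY lX lZ lY, word4 lY lY lY lY,
       word4 lY lY lZ lX, word4 lY lZ lX lY, word4 lY lZ lY lX, word4 lY lZ lZ lZ,
       word4 lZ lX lY lY, word4 lZ lX lZ lX, word4 lZ lY lX lY, word4 lZ lY lY lX,
       word4 lZ lY lZ lZ, word4 lZ lZ lX lX, word4 lZ lZ lY lZ]"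
  show "distinct ?T" "0 \<notin> set ?T" "\<forall>x\<in>set ?T. qform (word4 lY lY lY lY) x = 0"
    by simp_all
  show "(\<Sum>a\<leftarrow>?T. flip_row (word4 lY lY lY lY) a) = of_int (480)"
    by (simp add: flip_row_def sum_UNIV_bit prod_4 sum_letter, (simp add: algebra_simps)?)
  show "(\<Sum>a\<leftarrow>?T. \<Sum>b\<leftarrow>?T. if symp a b = 0 then phase a b * (if a + b \<in> set ?T then 4 else 12) else 0) = of_int (1860)"
    by simp
  show "24 * int (card (negative_lines_in (quadric_of (qform (word4 lY lY lY lY))))) + 3 * (480) - 2 * (1860) = 24 * int 517"
    by (simp add: card_negative_lines_four_qubits)
qed

section \<open>The type of a quadric, read off from \<open>p\<close>\<close>

lemma hyperbolic_quadric_qform: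
  "even (elliptic_letters p) \<Longrightarrow> hyperbolic_quadric (quadric_of (qform p))"
  unfolding hyperbolic_quadric_def
  by (intro exI[of _ "qform p"]) (simp add: symp_quadratic_form_qform witt_index_qform)

lemma elliptic_quadric_qform:
  "odd (elliptic_letters p) \<Longrightarrow> elliptic_quadric (quadric_of (qform p))"
  unfolding elliptic_quadric_def
  by (intro exI[of _ "qform p"]) (simp add: symp_quadratic_form_qform witt_index_qform)

text \<open>The count 612 occurs only for four letters Y, and only one word has them. As an
  equivalence it gives both uniqueness and the bound for every such \<open>S\<close>.\<close>

lemma four_qubit_quadric_612:
  fixes S :: "4 symplectic_vec set"
  shows "hyperbolic_quadric S \<and> card (negative_lines_in S) = 612
     \<longleftrightarrow> S = quadric_of (qform (word4 lY lY lY lY))"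
proof
  assume S: "hyperbolic_quadric S \<and> card (negative_lines_in S) = 612"
  then obtain p where p: "S = quadric_of (qform p)"
    by (auto simp: hyperbolic_quadric_def symp_quadratic_form_iff)
  have "elliptic_letters p \<in> {0, 1, 2, 3, 4}"
    using elliptic_letters_le[of p] by auto
  then have "elliptic_letters p = 4"
    using S p by (auto simp: card_negative_lines_four_qubits)
  then have "{j. letter p j = lY} = UNIV"
    by (intro card_subset_eq) (auto simp: elliptic_letters_def)
  then have "p = word4 lY lY lY lY" by (auto simp: word4_eq_iff set_eq_iff)
  with p show "S = quadric_of (qform (word4 lY lY lY lY))" by simp
next
  assume "S = quadric_of (qform (word4 lY lY lY lY))"
  then show "hyperbolic_quadric S \<and> card (negative_lines_in S) = 612"
    by (simp add: hyperbolic_quadric_qform card_negative_lines_four_qubits)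
qed

theorem mainTheorem6:
  shows "(\<exists>S :: 4 symplectic_vec set.
            elliptic_quadric S \<and> card (negative_lines_in S) = 360 \<and> quadric_degree S \<le> 351)
       \<and> (\<exists>S :: 4 symplectic_vec set.
            elliptic_quadric S \<and> card (negative_lines_in S) = 384 \<and> quadric_degree S \<le> 363)
       \<and> (\<exists>S :: 4 symplectic_vec set.
            hyperbolic_quadric S \<and> card (negative_lines_in S) = 532 \<and> quadric_degree S \<le> 500)
       \<and> (\<exists>S :: 4 symplectic_vec set.
            hyperbolic_quadric S \<and> card (negative_lines_in S) = 604 \<and> quadric_degree S \<le> 500)
       \<and> (\<exists>!S :: 4 symplectic_vec set.
            hyperbolic_quadric S \<and> card (negative_lines_in S) = 612)
       \<and> (\<forall>S :: 4 symplectic_vec set.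
            hyperbolic_quadric S \<and> card (negative_lines_in S) = 612 \<longrightarrow> quadric_degree S \<le> 517)"
proof (intro conjI)
  \<comment> \<open>There is one witness for each number of letters Y below four; the bounds 349,
    362, 498 and 498 obtained for them are slightly sharper than required.\<close>
  show "\<exists>S :: 4 symplectic_vec set.
      elliptic_quadric S \<and> card (negative_lines_in S) = 360 \<and> quadric_degree S \<le> 351"
    using quadric_degree_YYYI
    by (intro exI[of _ "quadric_of (qform (word4 lY lY lY lI))"])
       (simp add: elliptic_quadric_qform card_negative_lines_four_qubits)
  show "\<exists>S :: 4 symplectic_vec set.
      elliptic_quadric S \<and> card (negative_lines_in S) = 384 \<and> quadric_degree S \<le> 363"
    using quadric_degree_YIII
    by (intro exI[of _ "quadric_of (qform (word4 lY lI lI lI))"])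
       (simp add: elliptic_quadric_qform card_negative_lines_four_qubits)
  show "\<exists>S :: 4 symplectic_vec set.
      hyperbolic_quadric S \<and> card (negative_lines_in S) = 532 \<and> quadric_degree S \<le> 500"
    using quadric_degree_IIII
    by (intro exI[of _ "quadric_of (qform (word4 lI lI lI lI))"])
       (simp add: hyperbolic_quadric_qform card_negative_lines_four_qubits)
  show "\<exists>S :: 4 symplectic_vec set.
      hyperbolic_quadric S \<and> card (negative_lines_in S) = 604 \<and> quadric_degree S \<le> 500"
    using quadric_degree_YYII
    by (intro exI[of _ "quadric_of (qform (word4 lY lY lI lI))"])
       (simp add: hyperbolic_quadric_qform card_negative_lines_four_qubits)
  show "\<exists>!S :: 4 symplectic_vec set. hyperbolic_quadric S \<and> card (negative_lines_in S) = 612"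
    by (simp add: four_qubit_quadric_612)
  show "\<forall>S :: 4 symplectic_vec set.
      hyperbolic_quadric S \<and> card (negative_lines_in S) = 612 \<longrightarrow> quadric_degree S \<le> 517"
    using quadric_degree_YYYY by (simp add: four_qubit_quadric_612)
qed

end
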